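(* Let $m\ge 1$ and $N\ge 1$ be integers, $h=1/N$, $z\in[0,1]$, and let $\stackrel{\circ}{\ell}$ be the error functional (at the point $z$) of the lattice optimal interpolation formula with nodes $x_\beta=h\beta$, $\beta=1,\dots,N$, in $\widetilde{L_2^{(m)}}(0,1)$. Then $$\left\|\stackrel{\circ}{\ell}\,|\,\widetilde{L_2^{(m)*}}(0,1)\right\|^2=(-1)^m\Bigg[\sum_{k\ne 0}\frac{1}{(2\pi i k)^{2m}}-\sum_{k\neq 0,\ kh\in\mathbb{Z}}\frac{2\exp(-2\pi i k z)-1}{(2\pi i k)^{2m}}-\sum_{kh\notin\mathbb{Z}}\frac{L(k)}{(2\pi i k)^{2m}}\sum_{t\in\mathbb{Z}}\frac{\exp(2\pi i z t h^{-1})}{(th^{-1}-k)^{2m}}\Bigg],$$ where $k$ ranges over integers and $$L(k)=\left(\sum_{\gamma\in\mathbb{Z}}\frac{h^{2m}}{(\gamma-kh)^{2m}}\right)^{-1}.$$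
   Context: $\widetilde{L_2^{(m)}}(0,1)$ is the Hilbert space of real 1-periodic functions $\varphi$ on $\mathbb{R}$ with locally summable derivatives up to order $m$ and $\int_0^1(\varphi^{(m)}(x))^2dx<\infty$, where functions differing by a constant are identified, with norm $\|\varphi\|=\left(\int_0^1(\varphi^{(m)}(x))^2dx\right)^{1/2}$. For fixed $z$, the interpolation formula $\varphi(z)\cong\sum_{\beta=1}^N C_\beta(z)\varphi(h\beta)$ has error functional $(\ell,\varphi)=\varphi(z)-\sum_{\beta=1}^N C_\beta(z)\varphi(h\beta)$, subject to $(\ell,1)=0$, i.e. $\sum_{\beta=1}^N C_\beta(z)=1$; it belongs to the dual space $\widetilde{L_2^{(m)*}}(0,1)$, with norm $\|\ell\,|\,\widetilde{L_2^{(m)*}}(0,1)\|=\sup_{\|\varphi\|=1}|(\ell,\varphi)|$. The lattice optimal interpolation formula is the one whose coefficients minimize this norm among all real coefficients satisfying $\sum_{\beta=1}^N C_\beta(z)=1$ (the minimizer is unique); $\stackrel{\circ}{\ell}$ denotes its error functional. *)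

theory Defs
  imports "HOL-Analysis.Analysis"
begin

text \<open>
  \<open>g\<close> is a locally summable derivative of \<open>f\<close>: \<open>f\<close> is an indefinite Lebesgue integral of \<open>g\<close>,
  i.e. \<open>f\<close> is locally absolutely continuous with \<open>f' = g\<close> almost everywhere. Equivalently \<open>f\<close> is
  the continuous representative of a function with weak derivative \<open>g\<close>, so that point values of
  \<open>f\<close> make sense. \<open>g\<close> is determined up to a null set.
\<close>
definition has_summable_deriv :: "(real \<Rightarrow> real) \<Rightarrow> (real \<Rightarrow> real) \<Rightarrow> bool" where
  "has_summable_deriv f g \<longleftrightarrow>
     (\<forall>a b. a \<le> b \<longrightarrow> g absolutely_integrable_on {a..b} \<and> (g has_integral (f b - f a)) {a..b})"

text \<open>
  The relational power demands a chain \<open>\<phi>, \<phi>', \<dots>, \<phi>\<^sup>(\<^sup>m\<^sup>)\<close> of locally summable derivatives.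
  For \<open>m \<ge> 1\<close> the chosen \<open>m\<close>-th derivative is unique up to a null set.
\<close>
definition nth_summable_deriv :: "nat \<Rightarrow> (real \<Rightarrow> real) \<Rightarrow> (real \<Rightarrow> real)" where
  "nth_summable_deriv m \<phi> = (SOME g. (has_summable_deriv ^^ m) \<phi> g)"

text \<open>
  Representatives of the elements of the periodic Sobolev space. Functions differing by a constant
  are identified in that space; instead of forming the quotient we keep the representatives, on
  which \<open>per_sobolev_norm\<close> is a seminorm. Both this seminorm and the functionals considered below
  are unchanged by adding constants (lemmas \<open>per_sobolev_norm_add_const\<close> and
  \<open>error_functional_add_const\<close>).
\<close>
definition per_sobolev :: "nat \<Rightarrow> (real \<Rightarrow> real) set" where
  "per_sobolev m = {\<phi>. (\<forall>x. \<phi> (x + 1) = \<phi> x) \<and> (\<exists>g. (has_summable_deriv ^^ m) \<phi> g) \<and>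
     (\<lambda>x. (nth_summable_deriv m \<phi> x)\<^sup>2) integrable_on {0..1}}"

definition per_sobolev_norm :: "nat \<Rightarrow> (real \<Rightarrow> real) \<Rightarrow> real" where
  "per_sobolev_norm m \<phi> = sqrt (integral {0..1} (\<lambda>x. (nth_summable_deriv m \<phi> x)\<^sup>2))"

definition dual_norm :: "nat \<Rightarrow> ((real \<Rightarrow> real) \<Rightarrow> real) \<Rightarrow> real" where
  "dual_norm m l = (SUP \<phi> \<in> {\<phi> \<in> per_sobolev m. per_sobolev_norm m \<phi> = 1}. \<bar>l \<phi>\<bar>)"

definition error_functional ::
    "real \<Rightarrow> nat \<Rightarrow> real \<Rightarrow> (nat \<Rightarrow> real) \<Rightarrow> (real \<Rightarrow> real) \<Rightarrow> real" where
  "error_functional h N z C \<phi> = \<phi> z - (\<Sum>\<beta>=1..N. C \<beta> * \<phi> (h * real \<beta>))"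

text \<open>The constraint on the coefficients says that the error functional annihilates constants.\<close>
definition optimal_coeffs :: "nat \<Rightarrow> real \<Rightarrow> nat \<Rightarrow> real \<Rightarrow> (nat \<Rightarrow> real) \<Rightarrow> bool" where
  "optimal_coeffs m h N z C \<longleftrightarrow> (\<Sum>\<beta>=1..N. C \<beta>) = 1 \<and>
     (\<forall>D. (\<Sum>\<beta>=1..N. D \<beta>) = 1 \<longrightarrow>
        dual_norm m (error_functional h N z C) \<le> dual_norm m (error_functional h N z D))"

definition L_coeff :: "nat \<Rightarrow> real \<Rightarrow> int \<Rightarrow> real" where
  "L_coeff m h k =
     inverse (\<Sum>\<^sub>\<infinity>\<gamma>\<in>(UNIV::int set). h ^ (2 * m) / (of_int \<gamma> - of_int k * h) ^ (2 * m))"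

lemma error_functional_add_const:
  assumes "(\<Sum>\<beta>=1..N. C \<beta>) = 1"
  shows "error_functional h N z C (\<lambda>x. \<phi> x + c) = error_functional h N z C \<phi>"
proof -
  have "(\<Sum>\<beta>=1..N. C \<beta> * c) = c"
    using assms by (simp flip: sum_distrib_right)
  then show ?thesis
    by (simp add: error_functional_def distrib_left sum.distrib)
qed

lemma per_sobolev_norm_add_const:
  assumes "m \<ge> 1"
  shows "per_sobolev_norm m (\<lambda>x. \<phi> x + c) = per_sobolev_norm m \<phi>"
proof -
  obtain n where m: "m = Suc n"
    using assms by (cases m) auto
  have "has_summable_deriv (\<lambda>x. \<phi> x + c) g = has_summable_deriv \<phi> g" for g
    by (simp add: has_summable_deriv_def)
  then have "(has_summable_deriv ^^ m) (\<lambda>x. \<phi> x + c) g = (has_summable_deriv ^^ m) \<phi> g" for g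
    unfolding m by (blast intro: relpowp_Suc_I2 dest: relpowp_Suc_D2)
  then show ?thesis
    by (simp add: per_sobolev_norm_def nth_summable_deriv_def)
qed

end

theory Submission
  imports Defs
begin

text \<open>
  Repeated integration by parts against the periodic Bernoulli functions represents the error
  functional as \<open>\<phi> \<mapsto> \<integral> \<phi>\<^sup>(\<^sup>m\<^sup>) G\<close> with an explicit kernel \<open>G\<close>. By Cauchy-Schwarz its norm
  is the \<open>L\<^sup>2\<close> norm of \<open>G\<close>, attained at the \<open>m\<close>-fold antiderivative of \<open>G\<close>, which is again built
  from Bernoulli functions. Expanding the Bernoulli function of order \<open>2m\<close> into its Fourier series
  turns the square of the norm into \<open>\<Sum>k\<noteq>0. \<bar>exp(2\<pi>ikz) - d(k)\<bar>\<^sup>2 / (2\<pi>k)\<^sup>2\<^sup>m\<close>, where \<open>d\<close> is the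
  discrete Fourier transform of the coefficients. It is \<open>N\<close>-periodic and equals \<open>1\<close> on the
  multiples of \<open>N\<close>; on every other residue class its value is free, and completing the square yields
  the minimum. The minimising values have Hermitian symmetry, hence come from real coefficients.
\<close>

section \<open>Locally summable derivatives\<close>

text \<open>Two obstacles shape the analytic half. The top derivative is merely integrable and fixed
  only up to a null set, so integration by parts is derived directly from indefinite integrals, and
  almost-everywhere uniqueness makes the norm independent of the choice in
  \<open>nth_summable_deriv\<close>. The Bernoulli function of order one jumps and its Fourier
  series converges only conditionally; it is tied to order two through Abel means, while every order
  above two is differentiated termwise.

  Parseval's identity is bypassed: the squared norm is, up to the sign \<open>(-1) ^ m\<close>, the
  error functional applied to its own kernel of order 2m, whose Fourier series converges absolutely
  even for m = 1.

  In the final formula the summands are complex and do not agree one by one with the squared moduli;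
  equality appears only after summation over a residue class. For the class of 0 it rests on the
  symmetry k -> -k.\<close>

lemma has_summable_derivD:
  assumes "has_summable_deriv f g" "a \<le> b"
  shows "g absolutely_integrable_on {a..b}" "(g has_integral (f b - f a)) {a..b}"
    "g integrable_on {a..b}" "integral {a..b} g = f b - f a"
  using assms unfolding has_summable_deriv_def by (blast intro: integral_unique)+

lemma has_summable_deriv_imp_continuous:
  assumes "has_summable_deriv f g"
  shows "continuous_on S f"
proof -
  have "continuous_on {a..b} f" for a b
  proof (cases "a \<le> b")
    case True
    have "continuous_on {a..b} (\<lambda>x. f a + integral {a..x} g)"
      by (intro continuous_intros indefinite_integral_continuous_1 has_summable_derivD(3)[OF assms True])
    then show ?thesis
      by (rule continuous_on_eq) (use has_summable_derivD(4)[OF assms] in auto)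
  qed auto
  then have "isCont f x" for x
    using continuous_on_interior[of "{x-1..x+1}" f x] by auto
  then show ?thesis
    by (simp add: continuous_at_imp_continuous_on)
qed

lemma has_summable_deriv_DERIV:
  assumes "has_summable_deriv f g" "continuous_on UNIV g"
  shows "(f has_real_derivative g x) (at x)"
proof -
  have "((\<lambda>u. integral {x-1..u} g) has_real_derivative g x) (at x within {x-1..x+1})"
    by (rule integral_has_real_derivative) (use assms(2) continuous_on_subset in auto)
  then have "((\<lambda>u. f (x-1) + integral {x-1..u} g) has_real_derivative g x) (at x within {x-1..x+1})"
    by (auto intro!: derivative_eq_intros)
  then have "(f has_real_derivative g x) (at x within {x-1..x+1})"
    by (rule has_field_derivative_transform_within[OF _ zero_less_one])
       (use has_summable_derivD(4)[OF assms(1)] in auto)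
  then show ?thesis
    by (simp add: at_within_Icc_at)
qed

lemma has_summable_deriv_from_DERIV:
  assumes "\<And>x. (f has_real_derivative g x) (at x)" "continuous_on UNIV g"
  shows "has_summable_deriv f g"
  unfolding has_summable_deriv_def
proof (intro allI impI conjI)
  fix a b :: real assume ab: "a \<le> b"
  show "g absolutely_integrable_on {a..b}"
    by (intro absolutely_integrable_continuous_real continuous_on_subset[OF assms(2)]) auto
  show "(g has_integral f b - f a) {a..b}"
    by (intro fundamental_theorem_of_calculus ab)
       (use assms(1) in \<open>auto simp: has_real_derivative_iff_has_vector_derivative[symmetric]
          intro: has_field_derivative_at_within\<close>)
qed

text \<open>Continuity of \<open>g\<close> turns it into a classical derivative. A merely integrable
  \<open>g\<close> is fixed only up to a null set and need not be periodic at every point.\<close>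

lemma has_summable_deriv_periodic:
  assumes "has_summable_deriv f g" "continuous_on UNIV g" "\<And>x. f (x + 1) = f x"
  shows "g (x + 1) = g x"
proof -
  have "((\<lambda>x. f (x + 1)) has_real_derivative g (x + 1)) (at x)"
    using has_summable_deriv_DERIV[OF assms(1,2), of "x + 1"] by (subst DERIV_shift [symmetric])
  then show ?thesis
    using DERIV_unique[OF _ has_summable_deriv_DERIV[OF assms(1,2)]] unfolding assms(3) by blast
qed

lemma has_summable_deriv_scale:
  assumes "has_summable_deriv f g"
  shows "has_summable_deriv (\<lambda>x. c * f x) (\<lambda>x. c * g x)"
  unfolding has_summable_deriv_def
proof (intro allI impI conjI)
  fix a b :: real assume ab: "a \<le> b"
  note D = has_summable_derivD[OF assms ab]
  show "(\<lambda>x. c * g x) absolutely_integrable_on {a..b}"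
    using D by (intro set_integrable_mult_right)
  show "((\<lambda>x. c * g x) has_integral c * f b - c * f a) {a..b}"
    using has_integral_mult_right[OF D(2), of c] by (simp add: algebra_simps)
qed

lemma has_summable_deriv_diff:
  assumes "has_summable_deriv f g" "has_summable_deriv f' g'"
  shows "has_summable_deriv (\<lambda>x. f x - f' x) (\<lambda>x. g x - g' x)"
  unfolding has_summable_deriv_def
proof (intro allI impI conjI)
  fix a b :: real assume ab: "a \<le> b"
  note D = has_summable_derivD[OF assms(1) ab] has_summable_derivD[OF assms(2) ab]
  show "(\<lambda>x. g x - g' x) absolutely_integrable_on {a..b}"
    using D by (intro set_integral_diff)
  show "((\<lambda>x. g x - g' x) has_integral f b - f' b - (f a - f' a)) {a..b}"
    using has_integral_diff[OF D(2) D(6)] by (simp add: algebra_simps)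
qed

lemma has_summable_deriv_sum:
  assumes "\<And>i. i \<in> I \<Longrightarrow> has_summable_deriv (f i) (g i)"
  shows "has_summable_deriv (\<lambda>x. \<Sum>i\<in>I. f i x) (\<lambda>x. \<Sum>i\<in>I. g i x)"
proof (cases "finite I")
  case True
  show ?thesis
    unfolding has_summable_deriv_def
  proof (intro allI impI conjI)
    fix a b :: real assume ab: "a \<le> b"
    note D = has_summable_derivD[OF assms ab]
    show "(\<lambda>x. \<Sum>i\<in>I. g i x) absolutely_integrable_on {a..b}"
      using D by (intro absolutely_integrable_sum True)
    show "((\<lambda>x. \<Sum>i\<in>I. g i x) has_integral (\<Sum>i\<in>I. f i b) - (\<Sum>i\<in>I. f i a)) {a..b}"
      using has_integral_sum[OF True D(2)] by (simp add: sum_subtractf)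
  qed
qed (simp add: has_summable_deriv_def)

lemma has_summable_deriv_reflect:
  assumes "has_summable_deriv f g"
  shows "has_summable_deriv (\<lambda>t. f (x - t)) (\<lambda>t. - g (x - t))"
  unfolding has_summable_deriv_def
proof (intro allI impI conjI)
  fix a b :: real assume ab: "a \<le> b"
  have I: "((\<lambda>t. k (x - t)) has_integral i) {a..b}" if "(k has_integral i) {x-b..x-a}"
    for k :: "real \<Rightarrow> real" and i
  proof -
    have "((\<lambda>t. k (- t + x)) has_integral i) ((\<lambda>t. x - t) ` {x-b..x-a})"
      using has_integral_affinity[of k i "x-b" "x-a" "-1" x] that
      by (simp add: algebra_simps)
    then show ?thesis by (simp add: algebra_simps)
  qed
  note D = has_summable_derivD[OF assms, of "x-b" "x-a"]
  have ai: "g absolutely_integrable_on {x-b..x-a}" using D ab by simp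
  have "(\<lambda>t. g (x - t)) absolutely_integrable_on {a..b}"
    using ai I[of g] I[of "\<lambda>t. \<bar>g t\<bar>"] unfolding absolutely_integrable_on_def integrable_on_def
    by (auto simp: real_norm_def)
  then show "(\<lambda>t. - g (x - t)) absolutely_integrable_on {a..b}"
    using set_integrable_mult_right[of "-1" lebesgue "{a..b}" "\<lambda>t. g (x - t)"] by simp
  show "((\<lambda>t. - g (x - t)) has_integral f (x - b) - f (x - a)) {a..b}"
    using has_integral_neg[OF I[OF D(2)]] ab by simp
qed

section \<open>Integration by parts\<close>

text \<open>The increment of the defect \<open>f f' - \<integral>(g f' + f g')\<close> over a short interval is at most a modulus
  of continuity times \<open>\<integral>(\<bar>g\<bar> + \<bar>g'\<bar>)\<close>; summing over a fine partition makes it vanish.\<close>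
lemma has_integral_by_parts_summable_deriv:
  assumes fg: "has_summable_deriv f g" and fg': "has_summable_deriv f' g'" and ab: "a \<le> b"
  shows "(\<lambda>t. g t * f' t) absolutely_integrable_on {a..b}"
    "(\<lambda>t. f t * g' t) absolutely_integrable_on {a..b}"
    "integral {a..b} (\<lambda>t. g t * f' t) + integral {a..b} (\<lambda>t. f t * g' t) = f b * f' b - f a * f' a"
proof -
  have ai: "(\<lambda>t. k t * u t) absolutely_integrable_on {c..d}"
    if "has_summable_deriv u u'" "has_summable_deriv v k" "c \<le> d" for u u' v k :: "real \<Rightarrow> real" and c d
  proof -
    have c: "continuous_on {c..d} u" by (rule has_summable_deriv_imp_continuous[OF that(1)])
    have "(\<lambda>t. u t * k t) absolutely_integrable_on {c..d}"
    proof (rule absolutely_integrable_bounded_measurable_product_real)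
      show "u \<in> borel_measurable (lebesgue_on {c..d})"
        by (rule continuous_imp_measurable_on_sets_lebesgue[OF c]) auto
      show "bounded (u ` {c..d})"
        by (rule compact_imp_bounded[OF compact_continuous_image[OF c]]) auto
      show "k absolutely_integrable_on {c..d}"
        using has_summable_derivD[OF that(2,3)] by simp
    qed auto
    then show ?thesis by (simp add: mult.commute)
  qed
  show A1: "(\<lambda>t. g t * f' t) absolutely_integrable_on {a..b}"
    by (rule ai[OF fg' fg ab])
  show A2: "(\<lambda>t. f t * g' t) absolutely_integrable_on {a..b}"
    using ai[OF fg fg' ab] by (simp add: mult.commute)
  define k where "k t = g t * f' t + f t * g' t" for t
  have kint: "k integrable_on {c..d}" if "c \<le> d" for c d
    unfolding k_def using ai[OF fg' fg that] ai[OF fg fg' that]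
    by (intro integrable_add set_lebesgue_integral_eq_integral(1)) (simp_all add: mult.commute)
  define r where "r t = \<bar>g t\<bar> + \<bar>g' t\<bar>" for t
  have rint: "r integrable_on {c..d}" if "c \<le> d" for c d
    unfolding r_def using has_summable_derivD(1)[OF fg that] has_summable_derivD(1)[OF fg' that]
    by (intro integrable_add) (auto simp: absolutely_integrable_on_def)
  define H where "H t = f t * f' t - integral {a..t} k" for t
  \<comment> \<open>Freezing \<open>f\<close> at the left end s and \<open>f'\<close> at the right
    end t makes the product increment exact: f t f' t - f s f' s = (f t - f s) f' t + f s (f' t - f'
    s). Only oscillations of \<open>f\<close> and \<open>f'\<close> then remain under the
    integral.\<close>
  have step: "\<bar>H t - H s\<bar> \<le> e * integral {s..t} r"
    if st: "a \<le> s" "s \<le> t" and e: "\<And>x. x \<in> {s..t} \<Longrightarrow> \<bar>f s - f x\<bar> \<le> e"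
      "\<And>x. x \<in> {s..t} \<Longrightarrow> \<bar>f' t - f' x\<bar> \<le> e" for s t e
  proof -
    note D = has_summable_derivD[OF fg st(2)] and D' = has_summable_derivD[OF fg' st(2)]
    have comb: "integral {a..s} k + integral {s..t} k = integral {a..t} k"
      by (rule Henstock_Kurzweil_Integration.integral_combine) (use st kint in auto)
    have "((\<lambda>x. (g x * f' t + f s * g' x) - k x) has_integral
        ((f t - f s) * f' t + f s * (f' t - f' s)) - integral {s..t} k) {s..t}"
      by (intro has_integral_diff has_integral_add has_integral_mult_left has_integral_mult_right
          D D' integrable_integral kint st)
    moreover have "((f t - f s) * f' t + f s * (f' t - f' s)) - integral {s..t} k = H t - H s"
      unfolding H_def using comb by (simp add: algebra_simps)
    ultimately have I: "((\<lambda>x. (g x * f' t + f s * g' x) - k x) has_integral (H t - H s)) {s..t}"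
      by simp
    have "norm (integral {s..t} (\<lambda>x. (g x * f' t + f s * g' x) - k x)) \<le> integral {s..t} (\<lambda>x. e * r x)"
    proof (rule integral_norm_bound_integral)
      show "(\<lambda>x. g x * f' t + f s * g' x - k x) integrable_on {s..t}" using I by blast
      show "(\<lambda>x. e * r x) integrable_on {s..t}"
        by (intro integrable_on_mult_right rint st)
      fix x assume x: "x \<in> {s..t}"
      have "(g x * f' t + f s * g' x) - k x = g x * (f' t - f' x) + g' x * (f s - f x)"
        by (simp add: k_def algebra_simps)
      also have "norm \<dots> \<le> \<bar>g x\<bar> * e + \<bar>g' x\<bar> * e"
        unfolding real_norm_def
        by (rule order_trans[OF abs_triangle_ineq])
           (auto simp: abs_mult intro!: add_mono mult_left_mono e x)
      finally show "norm (g x * f' t + f s * g' x - k x) \<le> e * r x"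
        by (simp add: r_def algebra_simps)
    qed
    then show ?thesis
      using integral_unique[OF I] by (simp add: integral_mult_right)
  qed
  have main: "\<bar>H b - H a\<bar> \<le> e * integral {a..b} r" if e: "e > 0" for e
  proof -
    have "uniformly_continuous_on {a..b} f" "uniformly_continuous_on {a..b} f'"
      by (intro compact_uniformly_continuous has_summable_deriv_imp_continuous[OF fg]
          has_summable_deriv_imp_continuous[OF fg'] compact_Icc)+
    then obtain d1 d2 where d: "d1 > 0" "d2 > 0"
      "\<And>x y. x \<in> {a..b} \<Longrightarrow> y \<in> {a..b} \<Longrightarrow> \<bar>y - x\<bar> < d1 \<Longrightarrow> \<bar>f y - f x\<bar> < e"
      "\<And>x y. x \<in> {a..b} \<Longrightarrow> y \<in> {a..b} \<Longrightarrow> \<bar>y - x\<bar> < d2 \<Longrightarrow> \<bar>f' y - f' x\<bar> < e"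
      unfolding uniformly_continuous_on_def dist_real_def using e by metis
    obtain n :: nat where n: "(b - a) / min d1 d2 < real n"
      using reals_Archimedean2 by blast
    have "n > 0"
      using n ab d by (cases n) (auto simp: field_simps split: if_splits)
    define x where "x i = a + real i * ((b - a) / real n)" for i
    have xstep: "x (Suc i) - x i = (b - a) / real n" for i
      unfolding x_def of_nat_Suc distrib_right by simp
    have small: "(b - a) / real n < min d1 d2"
    proof -
      have "b - a < real n * min d1 d2"
        using n d(1,2) by (simp add: pos_divide_less_eq del: min_less_iff_conj)
      then show ?thesis
        using \<open>n > 0\<close> by (simp add: pos_divide_less_eq mult.commute del: min_less_iff_conj)
    qed
    have x0: "x 0 = a" "x n = b" using \<open>n > 0\<close> by (auto simp: x_def)
    have xle: "a \<le> x i" "x i \<le> x (Suc i)" for i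
    proof -
      show "a \<le> x i" using ab by (simp add: x_def)
      have "0 \<le> (b - a) / real n" using ab by simp
      with xstep[of i] show "x i \<le> x (Suc i)" by linarith
    qed
    have "\<bar>H (x i) - H a\<bar> \<le> e * integral {a..x i} r" if "i \<le> n" for i
      using that
    proof (induction i)
      case (Suc i)
      have xb: "x (Suc i) \<le> b"
      proof -
        have "real (Suc i) * ((b - a) / real n) \<le> real n * ((b - a) / real n)"
          by (rule mult_right_mono) (use Suc ab in auto)
        then show ?thesis using x0(2) by (simp add: x_def)
      qed
      have lt: "\<bar>u - v\<bar> < min d1 d2" if "u \<in> {x i..x (Suc i)}" "v \<in> {x i..x (Suc i)}" for u v
        using that small xstep[of i] by auto
      have "\<bar>H (x (Suc i)) - H (x i)\<bar> \<le> e * integral {x i..x (Suc i)} r"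
      proof (rule step)
        fix y assume y: "y \<in> {x i..x (Suc i)}"
        have m: "y \<in> {a..b}" "x i \<in> {a..b}" "x (Suc i) \<in> {a..b}"
          using y xle[of i] xb by auto
        show "\<bar>f (x i) - f y\<bar> \<le> e"
          using d(3)[OF m(1) m(2)] lt[of "x i" y] y xle[of i] by fastforce
        show "\<bar>f' (x (Suc i)) - f' y\<bar> \<le> e"
          using d(4)[OF m(1) m(3)] lt[of "x (Suc i)" y] y xle[of i] by fastforce
      qed (use xle in auto)
      moreover have "integral {a..x i} r + integral {x i..x (Suc i)} r = integral {a..x (Suc i)} r"
        by (rule Henstock_Kurzweil_Integration.integral_combine)
           (use xle[of i] rint[of a "x (Suc i)"] in auto)
      then have "e * integral {a..x i} r + e * integral {x i..x (Suc i)} r =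
          e * integral {a..x (Suc i)} r"
        by (metis distrib_left)
      ultimately show ?case using Suc by auto
    qed (simp add: x0)
    from this[of n] show ?thesis by (simp add: x0)
  qed
  have "\<bar>H b - H a\<bar> \<le> 0"
  proof (rule field_le_epsilon)
    fix e :: real assume e: "e > 0"
    have R: "0 \<le> integral {a..b} r"
      by (rule integral_nonneg[OF rint[OF ab]]) (simp add: r_def)
    have "\<bar>H b - H a\<bar> \<le> e / (integral {a..b} r + 1) * integral {a..b} r"
      by (rule main) (use e R in auto)
    also have "\<dots> \<le> e" using e R by (simp add: field_simps)
    finally show "\<bar>H b - H a\<bar> \<le> 0 + e" by simp
  qed
  then have "integral {a..b} k = f b * f' b - f a * f' a"
    by (simp add: H_def)
  moreover have "integral {a..b} k = integral {a..b} (\<lambda>t. g t * f' t) + integral {a..b} (\<lambda>t. f t * g' t)"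
    unfolding k_def using A1 A2 by (intro integral_add set_lebesgue_integral_eq_integral(1))
  ultimately show "integral {a..b} (\<lambda>t. g t * f' t) + integral {a..b} (\<lambda>t. f t * g' t) =
      f b * f' b - f a * f' a"
    by simp
qed

section \<open>Uniqueness of locally summable derivatives\<close>

text \<open>Half-lines form an intersection-stable generator of the Borel sets, and the sets over
  which \<open>f\<close> integrates to zero are closed under complements and disjoint countable
  unions. Complements need the integral over the whole line, obtained by exhausting it with
  half-lines.\<close>

lemma AE_zero_if_halfline_integrals_zero:
  fixes f :: "real \<Rightarrow> real"
  assumes f: "integrable lborel f" and 0: "\<And>a. set_lebesgue_integral lborel {a<..} f = 0"
  shows "AE x in lborel. f x = 0"
proof (rule sigma_finite_measure.density_zero[OF lborel.sigma_finite_measure_axioms f])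
  have sint: "set_integrable lborel A f" if "A \<in> sets borel" for A
    unfolding set_integrable_def using that f by (intro integrable_mult_indicator) auto
  have "(\<lambda>n. set_lebesgue_integral lborel {- real n<..} f) \<longlonglongrightarrow>
      set_lebesgue_integral lborel (\<Union>n. {- real n<..}) f"
    by (rule set_integral_cont_up) (auto simp: incseq_def intro: sint)
  moreover have "(\<Union>n. {- real n<..}) = UNIV"
    using reals_Archimedean2 by (auto simp: minus_less_iff)
  ultimately have U: "set_lebesgue_integral lborel UNIV f = 0"
    using LIMSEQ_const_iff unfolding 0 by metis
  fix A :: "real set" assume "A \<in> sets lborel"
  then have A: "A \<in> sigma_sets UNIV (range (\<lambda>a::real. {a<..}))"
    unfolding sets_lborel borel_Ioi by simp
  have "Int_stable (range (\<lambda>a::real. {a<..}))"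
    by (auto simp: Int_stable_def lessThan_Int_lessThan)
  from this subset_UNIV[of "range (\<lambda>a::real. {a<..})", folded Pow_UNIV] A show
      "set_lebesgue_integral lborel A f = 0"
  proof (induction rule: sigma_sets_induct_disjoint)
    case (basic A)
    then show ?case using 0 by auto
  next
    case empty
    show ?case by (simp add: set_lebesgue_integral_def)
  next
    case (compl A)
    have A: "A \<in> sets borel" using compl(1) unfolding borel_Ioi by simp
    have "set_lebesgue_integral lborel ((UNIV - A) \<union> A) f
      = set_lebesgue_integral lborel (UNIV - A) f + set_lebesgue_integral lborel A f"
      by (rule set_integral_Un) (use A in \<open>auto intro!: sint\<close>)
    then show ?case using U compl by (simp add: Un_commute)
  next
    case (union A)
    have A: "A i \<in> sets borel" for i using union(2) unfolding borel_Ioi by auto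
    have "(LINT x:(\<Union>i. A i)|lborel. f x) = (\<Sum>i. (LINT x:(A i)|lborel. f x))"
      by (rule lebesgue_integral_countable_add)
         (use A union(1) in \<open>auto intro!: sint simp: disjoint_family_on_def\<close>)
    then show ?case using union by simp
  qed
qed

text \<open>Reduction to \<open>AE_zero_if_halfline_integrals_zero\<close>: extend \<open>f\<close>
  by zero outside the interval and replace the result by a Borel function equal to it almost
  everywhere.\<close>

lemma negligible_if_interval_integrals_zero:
  fixes f :: "real \<Rightarrow> real"
  assumes f: "f absolutely_integrable_on {a..b}"
    and 0: "\<And>c. c \<in> {a..b} \<Longrightarrow> integral {c..b} f = 0"
  shows "negligible {x \<in> {a..b}. f x \<noteq> 0}"
proof (cases "a \<le> b")
  case True
  define F where "F x = indicator {a..b} x * f x" for x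
  have F: "integrable lebesgue F"
    using f unfolding set_integrable_def F_def by simp
  obtain g where g: "g \<in> borel_measurable lborel" "AE x in lborel. F x = g x"
    using completion_ex_borel_measurable_real[OF borel_measurable_integrable[OF F]] by blast
  have gL: "integrable lebesgue g"
    by (rule integrable_cong_AE_imp[OF F measurable_completion[OF g(1)] AE_completion[OF g(2)]])
  have gi: "integrable lborel g"
    using gL integrable_completion[OF g(1)] by simp
  \<comment> \<open>Meeting {c<..} with {a..b} leaves the whole interval, a right-hand piece or
    nothing, so integrals up to b suffice.\<close>
  have "set_lebesgue_integral lborel {c<..} g = 0" for c
  proof -
    have "set_lebesgue_integral lborel {c<..} g = set_lebesgue_integral lebesgue {c<..} g"
      unfolding set_lebesgue_integral_def by (rule integral_completion[symmetric]) (use g in auto)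
    also have "\<dots> = set_lebesgue_integral lebesgue {c<..} F"
      unfolding set_lebesgue_integral_def
    proof (rule integral_cong_AE)
      show "(\<lambda>x. indicator {c<..} x *\<^sub>R g x) \<in> borel_measurable lebesgue"
        "(\<lambda>x. indicator {c<..} x *\<^sub>R F x) \<in> borel_measurable lebesgue"
        by (rule borel_measurable_integrable[OF integrable_mult_indicator[OF _ gL]]
              borel_measurable_integrable[OF integrable_mult_indicator[OF _ F]]; simp)+
      show "AE x in lebesgue. indicator {c<..} x *\<^sub>R g x = indicator {c<..} x *\<^sub>R F x"
        using AE_completion[OF g(2)] by eventually_elim simp
    qed
    also have "\<dots> = set_lebesgue_integral lebesgue ({c<..} \<inter> {a..b}) f"
      unfolding set_lebesgue_integral_def F_def
      by (intro Bochner_Integration.integral_cong) (auto simp: indicator_def)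
    also have "\<dots> = integral ({c<..} \<inter> {a..b}) f"
      by (rule set_lebesgue_integral_eq_integral(2))
         (rule set_integrable_subset[OF f], auto)
    also have "\<dots> = 0"
    proof (cases "c < a")
      case True
      then have "{c<..} \<inter> {a..b} = {a..b}" by auto
      then show ?thesis using 0[of a] \<open>a \<le> b\<close> by simp
    next
      case False
      then have eq: "{c<..} \<inter> {a..b} = {c<..b}" by auto
      have "integral {c<..b} f = integral {c..b} f"
        by (rule integral_spike_set; rule negligible_subset[of "{c}"]) auto
      then show ?thesis unfolding eq using 0[of c] False
        by (cases "c \<le> b") auto
    qed
    finally show ?thesis .
  qed
  then have "AE x in lborel. g x = 0"
    by (rule AE_zero_if_halfline_integrals_zero[OF gi])
  with g(2) have "AE x in lborel. F x = 0" by eventually_elim simp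
  then have "AE x in lebesgue. F x = 0" by (rule AE_completion)
  then obtain N where N: "N \<in> null_sets lebesgue" "{x. F x \<noteq> 0} \<subseteq> N"
    unfolding eventually_ae_filter by auto
  then have "negligible N" by (simp add: negligible_iff_null_sets)
  then show ?thesis
    by (rule negligible_subset) (use N in \<open>auto simp: F_def\<close>)
qed simp

lemma has_summable_deriv_unique_AE:
  assumes "has_summable_deriv f g" "has_summable_deriv f g'"
  shows "negligible {x \<in> {a..b}. g x \<noteq> g' x}"
proof -
  have D: "has_summable_deriv (\<lambda>x. 0) (\<lambda>x. g x - g' x)"
    using has_summable_deriv_diff[OF assms] by simp
  have "negligible {x \<in> {a..b}. g x - g' x \<noteq> 0}"
  proof (cases "a \<le> b")
    case True
    then show ?thesis
      using has_summable_derivD[OF D] by (intro negligible_if_interval_integrals_zero) auto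
  qed simp
  then show ?thesis by simp
qed

text \<open>The intermediate derivatives are themselves indefinite integrals, hence continuous, so
  they are classical derivatives and coincide everywhere. Only the last one is ambiguous.\<close>

lemma nth_summable_deriv_unique_AE:
  assumes "(has_summable_deriv ^^ Suc n) f g" "(has_summable_deriv ^^ Suc n) f g'"
  shows "negligible {x \<in> {a..b}. g x \<noteq> g' x}"
  using assms
proof (induction n arbitrary: f)
  case 0
  have "has_summable_deriv f g" "has_summable_deriv f g'"
    using 0 by (metis relpowp_1 One_nat_def)+
  then show ?case by (rule has_summable_deriv_unique_AE)
next
  case (Suc n)
  obtain u where u: "has_summable_deriv f u" "(has_summable_deriv ^^ Suc n) u g"
    using relpowp_Suc_D2[OF Suc.prems(1)] by blast
  obtain v where v: "has_summable_deriv f v" "(has_summable_deriv ^^ Suc n) v g'"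
    using relpowp_Suc_D2[OF Suc.prems(2)] by blast
  have "continuous_on UNIV u" "continuous_on UNIV v"
    using relpowp_Suc_D2[OF u(2)] relpowp_Suc_D2[OF v(2)] has_summable_deriv_imp_continuous by blast+
  then have "u = v"
    by (intro ext DERIV_unique[OF has_summable_deriv_DERIV[OF u(1)] has_summable_deriv_DERIV[OF v(1)]])
  then show ?case using Suc.IH u v by blast
qed

section \<open>Periodic Bernoulli functions\<close>

text \<open>Sum of the modes k = n + 1 and k = -(n + 1) of exp(2 pi i k x) / (2 pi i k)^j. The phase
  j pi/2 is the argument of i^j, which gives all orders one formula.\<close>

definition per_bernoulli_term :: "nat \<Rightarrow> nat \<Rightarrow> real \<Rightarrow> real" where
  "per_bernoulli_term j n x = 2 * cos (2 * pi * real (Suc n) * x - real j * (pi / 2)) / (2 * pi *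
      real (Suc n)) ^ j"

text \<open>Equals \<open>- B\<^sub>j({x}) / j!\<close> and has the Fourier coefficients \<open>1 / (2 \<pi> i k)^j\<close> for \<open>k \<noteq> 0\<close>.
  The series does not converge absolutely for \<open>j = 1\<close>, where the closed form is used instead.\<close>
definition per_bernoulli :: "nat \<Rightarrow> real \<Rightarrow> real" where
  "per_bernoulli j x =
     (if j = 1 then (if x \<in> \<int> then 0 else 1 / 2 - frac x) else (\<Sum>n. per_bernoulli_term j n x))"

lemma per_bernoulli_term_periodic: "per_bernoulli_term j n (x + 1) = per_bernoulli_term j n x"
proof -
  have "2 * pi * real (Suc n) * (x + 1) - real j * (pi / 2) =
      (2 * pi * real (Suc n) * x - real j * (pi / 2)) + 2 * pi * real (Suc n)"
    by (simp add: algebra_simps)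
  moreover have "cos (A + 2 * pi * real (Suc n)) = cos A" for A
  proof -
    have "2 * pi * real (Suc n) = 2 * real (Suc n) * pi" by simp
    then show ?thesis by (simp only: cos_add cos_2npi sin_2npi mult_1_right mult_zero_right diff_zero)
  qed
  ultimately show ?thesis
    unfolding per_bernoulli_term_def by (simp only:)
qed

lemma per_bernoulli_periodic: "per_bernoulli j (x + 1) = per_bernoulli j x"
proof -
  have "x + 1 \<in> \<int> \<longleftrightarrow> x \<in> \<int>"
    using Ints_add[of x 1] Ints_diff[of "x + 1" 1] by auto
  then show ?thesis
    by (simp add: per_bernoulli_def per_bernoulli_term_periodic frac_1_eq)
qed

lemma per_bernoulli_term_bound: "\<bar>per_bernoulli_term j n x\<bar> \<le> 2 * inverse (real (Suc n) ^ j)"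
proof -
  have "\<bar>per_bernoulli_term j n x\<bar> \<le> 2 / (2 * pi * real (Suc n)) ^ j"
    unfolding per_bernoulli_term_def by (simp add: abs_mult divide_right_mono)
  also have "\<dots> \<le> 2 / real (Suc n) ^ j"
    using pi_gt3 by (intro divide_left_mono power_mono mult_pos_pos zero_less_power) auto
  finally show ?thesis by (simp add: divide_inverse)
qed

lemma summable_per_bernoulli_bound:
  assumes "j \<ge> 2"
  shows "summable (\<lambda>n. 2 * inverse (real (Suc n) ^ j))"
proof (rule summable_mult)
  show "summable (\<lambda>n. inverse (real (Suc n) ^ j))"
    using inverse_power_summable[OF assms, where 'a = real]
    by (rule summable_Suc_iff[THEN iffD2])
qed

lemma per_bernoulli_term_DERIV:
  "(per_bernoulli_term (Suc j) n has_real_derivative per_bernoulli_term j n x) (at x)"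
proof -
  have eq: "cos (2 * pi * real (Suc n) * x - real j * (pi / 2)) =
    - sin (2 * pi * real (Suc n) * x - real (Suc j) * (pi / 2))"
  proof -
    have "2 * pi * real (Suc n) * x - real (Suc j) * (pi / 2) =
        (2 * pi * real (Suc n) * x - real j * (pi / 2)) - pi / 2"
      unfolding of_nat_Suc[of j] distrib_right by simp
    then show ?thesis by (simp only: sin_diff) simp
  qed
  have "((\<lambda>x. 2 * cos (2 * pi * real (Suc n) * x - real (Suc j) * (pi / 2)) / (2 * pi *
      real (Suc n)) ^ Suc j)
     has_real_derivative
       2 * (- sin (2 * pi * real (Suc n) * x - real (Suc j) * (pi / 2)) * (2 * pi * real (Suc n)))
         / (2 * pi * real (Suc n)) ^ Suc j) (at x)"
    by (rule derivative_eq_intros refl | simp)+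
  also have "2 * (- sin (2 * pi * real (Suc n) * x - real (Suc j) * (pi / 2)) * (2 * pi * real (Suc n)))
         / (2 * pi * real (Suc n)) ^ Suc j = per_bernoulli_term j n x"
    unfolding per_bernoulli_term_def eq[symmetric] by simp
  finally show ?thesis
    by (simp add: per_bernoulli_term_def[abs_def])
qed

text \<open>From order j = 2 on, the differentiated series converges uniformly by the Weierstrass
  test. The passage from order two to order one needs Abel means instead.\<close>

lemma per_bernoulli_DERIV:
  assumes "j \<ge> 2"
  shows "(per_bernoulli (Suc j) has_real_derivative per_bernoulli j x) (at x)"
proof -
  have "((\<lambda>x. \<Sum>n. per_bernoulli_term (Suc j) n x) has_real_derivative (\<Sum>n. per_bernoulli_term j n
      x)) (at x)"
  proof (rule has_field_derivative_series'(2)[of UNIV])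
    show "uniformly_convergent_on UNIV (\<lambda>n x. \<Sum>i<n. per_bernoulli_term j i x)"
      by (rule Weierstrass_m_test'[OF _ summable_per_bernoulli_bound[OF assms]])
         (simp only: real_norm_def per_bernoulli_term_bound)
    show "summable (\<lambda>n. per_bernoulli_term (Suc j) n 0)"
      by (rule summable_comparison_test'[OF summable_per_bernoulli_bound[of "Suc j"]])
         (use assms in \<open>simp_all only: real_norm_def per_bernoulli_term_bound\<close>)
  qed (auto intro: per_bernoulli_term_DERIV)
  then show ?thesis using assms by (simp add: per_bernoulli_def[abs_def])
qed

section \<open>Abel means of the first-order Bernoulli series\<close>

context
  fixes r :: real assumes r: "0 < r" "r < 1"
begin

text \<open>This is the imaginary part of the power series of -Ln(1 - w)/pi at w = r cis(2 pi
  x).\<close>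

lemma abel_sum_first_per_bernoulli_terms:
  "(\<lambda>n. r ^ Suc n * per_bernoulli_term 1 n x) sums (- Im (Ln (1 - of_real r * cis (2 * pi * x))) / pi)"
proof -
  define z where "z = - (of_real r * cis (2 * pi * x))"
  have "(\<lambda>n. - ((- z) ^ n) / of_nat n) sums Ln (1 + z)"
    by (rule Ln_series') (use r in \<open>simp add: z_def norm_mult\<close>)
  \<comment> \<open>The term with n = 0 is -1/0 = 0, so shifting the index leaves the sum
    unchanged.\<close>
  then have "(\<lambda>n. - ((- z) ^ Suc n) / of_nat (Suc n)) sums Ln (1 + z)"
    by (subst sums_Suc_iff) simp
  then have "(\<lambda>n. - Im (- ((- z) ^ Suc n) / of_nat (Suc n)) / pi) sums (- Im (Ln (1 + z)) / pi)"
    by (intro sums_divide sums_minus sums_Im)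
  moreover have "- Im (- ((- z) ^ Suc n) / of_nat (Suc n)) / pi =
      r ^ Suc n * per_bernoulli_term 1 n x" for n
  proof -
    have "(- z) ^ Suc n = of_real (r ^ Suc n) * cis (real (Suc n) * (2 * pi * x))"
      by (simp only: z_def minus_minus power_mult_distrib Complex.DeMoivre of_real_power)
    moreover have "cos (2 * pi * real (Suc n) * x - real 1 * (pi / 2)) =
        sin (real (Suc n) * (2 * pi * x))"
    proof -
      have "2 * pi * real (Suc n) * x = real (Suc n) * (2 * pi * x)" by (simp only: mult_ac)
      then show ?thesis by (simp only: cos_diff) simp
    qed
    ultimately show ?thesis
      by (simp add: per_bernoulli_term_def del: of_nat_Suc power_Suc)
  qed
  ultimately show ?thesis by (simp add: z_def)
qed

text \<open>For r < 1 the geometric factor dominates the terms of every order uniformly in x, so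
  even the step from order two to order one is termwise.\<close>

lemma abel_sum_DERIV:
  "((\<lambda>x. \<Sum>n. r ^ Suc n * per_bernoulli_term 2 n x) has_real_derivative
     (- Im (Ln (1 - of_real r * cis (2 * pi * x))) / pi)) (at x)"
proof -
  have b: "\<bar>r ^ Suc n * per_bernoulli_term j n x\<bar> \<le> 2 * r ^ Suc n" for n j x
  proof -
    have "\<bar>per_bernoulli_term j n x\<bar> \<le> 2"
      using per_bernoulli_term_bound[of j n x] one_le_power[of "real (Suc n)" j]
      by (smt (verit) le_imp_inverse_le inverse_1 of_nat_Suc of_nat_0_le_iff)
    then show ?thesis
      using r mult_left_mono[of _ 2 "r ^ Suc n"] by (simp add: abs_mult mult.commute del: power_Suc)
  qed
  have s: "summable (\<lambda>n. 2 * r ^ Suc n)"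
    using r by (intro summable_mult) (subst summable_Suc_iff, simp add: summable_geometric)
  have "((\<lambda>x. \<Sum>n. r ^ Suc n * per_bernoulli_term 2 n x) has_real_derivative
      (\<Sum>n. r ^ Suc n * per_bernoulli_term 1 n x)) (at x)"
  proof (rule has_field_derivative_series'(2)[of UNIV])
    show "uniformly_convergent_on UNIV (\<lambda>n x. \<Sum>i<n. r ^ Suc i * per_bernoulli_term 1 i x)"
      by (rule Weierstrass_m_test'[OF _ s]) (simp only: real_norm_def b)
    show "summable (\<lambda>n. r ^ Suc n * per_bernoulli_term 2 n 0)"
      by (rule summable_comparison_test'[OF s]) (simp only: real_norm_def b)
    show "((\<lambda>x. r ^ Suc n * per_bernoulli_term 2 n x) has_real_derivative
       r ^ Suc n * per_bernoulli_term 1 n x) (at x within UNIV)" for n x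
      using DERIV_cmult[OF per_bernoulli_term_DERIV[of 1 n x]] by (simp add: numeral_2_eq_2)
  qed auto
  then show ?thesis
    using sums_unique[OF abel_sum_first_per_bernoulli_terms] by simp
qed

text \<open>The argument of Ln stays in the right half-plane, so its angle is below pi/2. As the
  bound does not depend on r, it serves as the dominating function when r tends to 1.\<close>

lemma abel_sum_bound: "\<bar>- Im (Ln (1 - of_real r * cis (2 * pi * x))) / pi\<bar> \<le> 1 / 2"
proof -
  have "Re (1 - of_real r * cis (2 * pi * x)) > 0"
  proof -
    have "r * cos (2 * pi * x) \<le> r * 1"
      by (rule mult_left_mono) (use r in auto)
    moreover have "Re (1 - of_real r * cis (2 * pi * x)) = 1 - r * cos (2 * pi * x)" by simp
    ultimately show ?thesis using r by linarith
  qed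
  then have "\<bar>Im (Ln (1 - of_real r * cis (2 * pi * x)))\<bar> < pi / 2"
    using Re_Ln_pos_lt by (metis less_irrefl zero_complex.simps(1))
  then show ?thesis by (simp add: field_simps)
qed

end

text \<open>With y = frac x, half-angle formulas give 1 - cis(2 pi y) = 2 sin(pi y) cis(pi y -
  pi/2), which reads off the logarithm. The positive real part keeps the limit point away from the
  branch cut, where \<open>Ln\<close> is continuous.\<close>

lemma Im_Ln_one_minus_cis:
  assumes "x \<notin> \<int>"
  shows "- Im (Ln (1 - cis (2 * pi * x))) / pi = 1 / 2 - frac x" "Re (1 - cis (2 * pi * x)) > 0"
proof -
  define y where "y = frac x"
  have y: "0 < y" "y < 1"
    using assms frac_lt_1[of x] frac_ge_0[of x] frac_eq_0_iff[of x] by (auto simp: y_def less_le)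
  have "2 * pi * x = 2 * pi * of_int \<lfloor>x\<rfloor> + 2 * pi * y"
    by (simp add: y_def frac_def algebra_simps)
  then have "cis (2 * pi * x) = cis (2 * pi * of_int \<lfloor>x\<rfloor>) * cis (2 * pi * y)"
    by (simp only: cis_mult)
  then have eq: "cis (2 * pi * x) = cis (2 * pi * y)" by simp
  have s: "sin (pi * y) > 0"
    using y by (intro sin_gt_zero) auto
  have c: "cos (2 * pi * y) = 1 - 2 * sin (pi * y) ^ 2" "sin (2 * pi * y) =
      2 * sin (pi * y) * cos (pi * y)"
    using cos_double_sin[of "pi * y"] sin_double[of "pi * y"] by (simp_all add: mult_ac)
  show "Re (1 - cis (2 * pi * x)) > 0" using s by (simp add: eq c)
  have "Ln (1 - cis (2 * pi * y)) = Complex (ln (2 * sin (pi * y))) (pi * y - pi / 2)"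
  proof (rule Ln_unique)
    have "exp (Complex (ln (2 * sin (pi * y))) (pi * y - pi / 2)) =
        of_real (2 * sin (pi * y)) * cis (pi * y - pi / 2)"
      using s by (simp add: exp_eq_polar exp_of_real)
    also have "\<dots> = 1 - cis (2 * pi * y)"
      by (simp add: complex_eq_iff c cos_diff sin_diff power2_eq_square)
    finally show "exp (Complex (ln (2 * sin (pi * y))) (pi * y - pi / 2)) = 1 - cis (2 * pi * y)" .
    have "0 < pi * y" "pi * y < pi" using y by auto
    then show "- pi < Im (Complex (ln (2 * sin (pi * y))) (pi * y - pi / 2))"
      "Im (Complex (ln (2 * sin (pi * y))) (pi * y - pi / 2)) \<le> pi"
      unfolding complex.sel by linarith+
  qed
  then have "Im (Ln (1 - cis (2 * pi * x))) = pi * y - pi / 2"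
    by (simp only: eq complex.sel)
  then show "- Im (Ln (1 - cis (2 * pi * x))) / pi = 1 / 2 - frac x"
    unfolding y_def[symmetric] by (simp only:) (simp add: field_simps)
qed

text \<open>Let r tend to 1 in the fundamental theorem of calculus for the Abel means: dominated
  convergence treats the integral, Tannery's theorem the boundary values.\<close>

lemma has_summable_deriv_per_bernoulli_1: "has_summable_deriv (per_bernoulli 2) (per_bernoulli 1)"
  unfolding has_summable_deriv_def
proof (intro allI impI)
  fix a b :: real assume ab: "a \<le> b"
  \<comment> \<open>The shift by 2 keeps r k strictly between 0 and 1 already at k = 0.\<close>
  define r where "r k = 1 - 1 / real (k + 2)" for k :: nat
  have r: "0 < r k" "r k < 1" for k by (auto simp: r_def field_simps)
  have "(\<lambda>k. 1 / real (k + 2)) \<longlonglongrightarrow> 0"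
    using LIMSEQ_ignore_initial_segment[OF lim_const_over_n[of "1::real"], of 2] by simp
  from tendsto_diff[OF tendsto_const[of 1] this] have rlim: "r \<longlonglongrightarrow> 1"
    unfolding r_def[abs_def] diff_0_right .
  define H where "H k x = (\<Sum>n. r k ^ Suc n * per_bernoulli_term 2 n x)" for k x
  define K where "K k x = - Im (Ln (1 - of_real (r k) * cis (2 * pi * x))) / pi" for k x
  have int: "(K k has_integral (H k b - H k a)) {a..b}" for k
    unfolding K_def H_def
    by (intro fundamental_theorem_of_calculus ab)
       (simp only: has_real_derivative_iff_has_vector_derivative[symmetric],
        rule has_field_derivative_at_within[OF abel_sum_DERIV[OF r]])
  have lim: "(\<lambda>k. K k x) \<longlonglongrightarrow> per_bernoulli 1 x" for x
  proof (cases "x \<in> \<int>")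
    \<comment> \<open>At an integer the argument of Ln is the positive real 1 - r k, so every Abel
      mean vanishes; hence the value 0 chosen there in \<open>per_bernoulli\<close>.\<close>
    case True
    have "1 - of_real (r k) * cis (2 * pi * x) = of_real (1 - r k)" for k
      using True by simp
    then have "K k x = 0" for k
      unfolding K_def using r[of k] by (simp only: Ln_of_real) simp
    then show ?thesis using True by (simp add: per_bernoulli_def)
  next
    case False
    note I = Im_Ln_one_minus_cis[OF False]
    have n: "1 - cis (2 * pi * x) \<notin> \<real>\<^sub>\<le>\<^sub>0"
      using I(2) by (auto simp: complex_nonpos_Reals_iff)
    have "(\<lambda>k. 1 - of_real (r k) * cis (2 * pi * x)) \<longlonglongrightarrow> 1 - of_real 1 * cis (2 * pi * x)"
      by (intro tendsto_intros rlim)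
    then have L: "(\<lambda>k. 1 - of_real (r k) * cis (2 * pi * x)) \<longlonglongrightarrow> 1 - cis (2 * pi * x)" by simp
    have "(\<lambda>k. K k x) \<longlonglongrightarrow> - Im (Ln (1 - cis (2 * pi * x))) / pi"
      unfolding K_def
      by (intro tendsto_divide tendsto_minus tendsto_Im tendsto_Ln L n tendsto_const pi_neq_zero)
    then show ?thesis using I(1) False by (simp add: per_bernoulli_def)
  qed
  have Hlim: "(\<lambda>k. H k x) \<longlonglongrightarrow> per_bernoulli 2 x" for x
  proof -
    have "eventually (\<lambda>n. summable (\<lambda>k. norm (r n ^ Suc k * per_bernoulli_term 2 k x))) sequentially \<and>
        summable (\<lambda>n. norm (per_bernoulli_term 2 n x)) \<and>
        ((\<lambda>n. suminf (\<lambda>k. r n ^ Suc k * per_bernoulli_term 2 k x)) \<longlongrightarrow> suminf (\<lambda>k. per_bernoulli_term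
            2 k x)) sequentially"
    proof (rule tannerys_theorem)
      show "summable (\<lambda>n. 2 * inverse (real (Suc n) ^ 2))"
        by (rule summable_per_bernoulli_bound) simp
      have "(\<lambda>n. r n ^ Suc k * per_bernoulli_term 2 k x) \<longlonglongrightarrow> 1 ^ Suc k * per_bernoulli_term 2 k x" for k
        by (intro tendsto_intros rlim)
      then show "(\<lambda>n. r n ^ Suc k * per_bernoulli_term 2 k x) \<longlonglongrightarrow> per_bernoulli_term 2 k x" for k
        by simp
      have "norm (r n ^ Suc k * per_bernoulli_term 2 k x) \<le> 2 * inverse (real (Suc k) ^ 2)" for k n
      proof -
        have "norm (r n ^ Suc k * per_bernoulli_term 2 k x) \<le> 1 * \<bar>per_bernoulli_term 2 k x\<bar>"
          unfolding real_norm_def abs_mult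
          by (rule mult_right_mono) (use r[of n] in \<open>auto simp: power_le_one simp del: power_Suc\<close>)
        also have "\<dots> \<le> 2 * inverse (real (Suc k) ^ 2)"
          using per_bernoulli_term_bound[of 2 k x] by simp
        finally show ?thesis .
      qed
      then show "eventually (\<lambda>(k,n). norm (r n ^ Suc k * per_bernoulli_term 2 k x)
          \<le> 2 * inverse (real (Suc k) ^ 2)) (at_top \<times>\<^sub>F sequentially)"
        by (intro always_eventually) auto
    qed simp
    then show ?thesis by (simp add: H_def per_bernoulli_def del: power_Suc)
  qed
  have "(per_bernoulli 1 has_integral per_bernoulli 2 b - per_bernoulli 2 a) {a..b}"
  proof (rule has_integral_dominated_convergence[OF int, where h = "\<lambda>_. 1/2"])
    show "\<forall>x\<in>{a..b}. norm (K k x) \<le> 1 / 2" for k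
      unfolding K_def real_norm_def using abel_sum_bound[OF r] by blast
    show "(\<lambda>k. H k b - H k a) \<longlonglongrightarrow> per_bernoulli 2 b - per_bernoulli 2 a"
      by (intro tendsto_diff Hlim)
  qed (use lim in auto)
  moreover have "per_bernoulli 1 absolutely_integrable_on {a..b}"
  proof (rule absolutely_integrable_integrable_bound[where g = "\<lambda>_. 1/2"])
    show "norm (per_bernoulli 1 x) \<le> 1/2" for x
      using frac_lt_1[of x] frac_ge_0[of x] by (auto simp: per_bernoulli_def abs_if)
  qed (use calculation in auto)
  ultimately show "per_bernoulli 1 absolutely_integrable_on {a..b} \<and>
      (per_bernoulli 1 has_integral per_bernoulli 2 b - per_bernoulli 2 a) {a..b}" by simp
qed

lemma has_summable_deriv_per_bernoulli:
  assumes "j \<ge> 1"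
  shows "has_summable_deriv (per_bernoulli (Suc j)) (per_bernoulli j)"
proof (cases "j = 1")
  case True
  then show ?thesis using has_summable_deriv_per_bernoulli_1 by (simp add: numeral_2_eq_2)
next
  case False
  have j: "j \<ge> 2" using False assms by simp
  have "continuous_on UNIV (per_bernoulli j)"
  \<comment> \<open>Order two is continuous as an indefinite integral of the jumping order one;
    higher orders are continuous because they are differentiable.\<close>
  proof (cases "j = 2")
    case True
    then show ?thesis using has_summable_deriv_imp_continuous[OF has_summable_deriv_per_bernoulli_1]
        by simp
  next
    case False
    then obtain i where i: "j = Suc i" "i \<ge> 2" using assms \<open>j \<noteq> 1\<close> by (cases j) auto
    show ?thesis unfolding i
      using DERIV_isCont[OF per_bernoulli_DERIV[OF i(2)]] by (simp add: continuous_at_imp_continuous_on)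
  qed
  then show ?thesis
    by (rule has_summable_deriv_from_DERIV[OF per_bernoulli_DERIV[OF j]])
qed

section \<open>The norm of an error functional\<close>

text \<open>As a function of t the kernel is t - x + 1/2 before x and t - x - 1/2 after it. Its unit
  jump produces u x; what remains does not depend on x and disappears under a functional that
  annihilates constants.\<close>

lemma per_bernoulli_1_representation:
  assumes ug: "has_summable_deriv u g" and per: "u 1 = u 0" and x: "x \<in> {0..1}"
  shows "((\<lambda>t. g t * per_bernoulli 1 (x - t)) has_integral
    (u x + (integral {0..1} (\<lambda>t. g t * t) - u 1))) {0..1}"
proof -
  have id: "has_summable_deriv (\<lambda>t. t) (\<lambda>_. 1)"
    by (rule has_summable_deriv_from_DERIV) auto
  have gt: "(\<lambda>t. g t * t) integrable_on {a..b}" if "a \<le> b" for a b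
    using has_integral_by_parts_summable_deriv(1)[OF ug id that]
        set_lebesgue_integral_eq_integral(1) by blast
  have I: "((\<lambda>t. g t * c + g t * t) has_integral (u b - u a) * c + integral {a..b} (\<lambda>t. g t * t)) {a..b}"
    if "a \<le> b" for a b c
    by (intro has_integral_add has_integral_mult_left has_summable_derivD(2)[OF ug that]
        integrable_integral gt that)
  have "((\<lambda>t. g t * per_bernoulli 1 (x - t)) has_integral
     (u x - u 0) * (1/2 - x) + integral {0..x} (\<lambda>t. g t * t)) {0..x}"
  \<comment> \<open>The endpoints are left out because x - t may be an integer there, where
    \<open>per_bernoulli 1\<close> is 0 instead of following the linear formula.\<close>
  proof (rule has_integral_spike_finite[OF _ _ I[of 0 x "1/2 - x"]])
    fix t assume t: "t \<in> {0..x} - {0, x}"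
    then have "frac (x - t) = x - t" "x - t \<noteq> 0"
      using x by (auto simp: frac_eq)
    moreover from this have "x - t \<notin> \<int>"
      by (metis frac_eq_0_iff)
    ultimately have "per_bernoulli 1 (x - t) = (1/2 - x) + t"
      by (simp add: per_bernoulli_def)
    then show "g t * per_bernoulli 1 (x - t) = g t * (1/2 - x) + g t * t"
      by (simp only: distrib_left)
  qed (use x in auto)
  moreover have "((\<lambda>t. g t * per_bernoulli 1 (x - t)) has_integral
     (u 1 - u x) * (- 1/2 - x) + integral {x..1} (\<lambda>t. g t * t)) {x..1}"
  proof (rule has_integral_spike_finite[OF _ _ I[of x 1 "- 1/2 - x"]])
    fix t assume t: "t \<in> {x..1} - {x, 1}"
    have "frac (x - t) = x - t + 1"
      using frac_1_eq[of "x - t"] frac_eq[of "x - t + 1"] t x by auto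
    moreover from this have "x - t \<notin> \<int>"
      using t x frac_eq_0_iff[of "x - t"] by auto
    ultimately have "per_bernoulli 1 (x - t) = (- 1/2 - x) + t"
      by (simp add: per_bernoulli_def)
    then show "g t * per_bernoulli 1 (x - t) = g t * (- 1/2 - x) + g t * t"
      by (simp only: distrib_left)
  qed (use x in auto)
  ultimately have "((\<lambda>t. g t * per_bernoulli 1 (x - t)) has_integral
     ((u x - u 0) * (1/2 - x) + integral {0..x} (\<lambda>t. g t * t)) +
     ((u 1 - u x) * (- 1/2 - x) + integral {x..1} (\<lambda>t. g t * t))) {0..1}"
    using x by (intro has_integral_combine[of 0 x 1]) auto
  moreover have "integral {0..x} (\<lambda>t. g t * t) + integral {x..1} (\<lambda>t. g t * t) =
      integral {0..1} (\<lambda>t. g t * t)"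
    by (rule Henstock_Kurzweil_Integration.integral_combine) (use x gt in auto)
  then have "((u x - u 0) * (1/2 - x) + integral {0..x} (\<lambda>t. g t * t)) +
     ((u 1 - u x) * (- 1/2 - x) + integral {x..1} (\<lambda>t. g t * t)) =
     u x + (integral {0..1} (\<lambda>t. g t * t) - u 1)"
    by (simp add: per field_simps)
  ultimately show ?thesis by simp
qed

lemma error_functional_scale:
  "error_functional h N z C (\<lambda>t. c * \<phi> t) = c * error_functional h N z C \<phi>"
  by (simp add: error_functional_def right_diff_distrib sum_distrib_left mult_ac)

text \<open>The Riesz representers: the value of the error functional at \<open>\<phi>\<close> is the \<open>L\<^sup>2\<close> inner product of
  \<open>\<phi>\<^sup>(\<^sup>m\<^sup>)\<close> with \<open>error_kernel m h N z C\<close>.\<close>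
definition error_kernel :: "nat \<Rightarrow> real \<Rightarrow> nat \<Rightarrow> real \<Rightarrow> (nat \<Rightarrow> real) \<Rightarrow> real \<Rightarrow> real" where
  "error_kernel j h N z C t = error_functional h N z C (\<lambda>x. per_bernoulli j (x - t))"

lemma error_kernel_periodic: "error_kernel j h N z C (t + 1) = error_kernel j h N z C t"
proof -
  have "per_bernoulli j (x - (t + 1)) = per_bernoulli j (x - t)" for x
    using per_bernoulli_periodic[of j "x - (t + 1)"] by simp
  then show ?thesis by (simp add: error_kernel_def)
qed

lemma has_summable_deriv_error_kernel:
  assumes "j \<ge> 1"
  shows "has_summable_deriv (error_kernel (Suc j) h N z C) (\<lambda>t. - error_kernel j h N z C t)"
proof -
  note R = has_summable_deriv_reflect[OF has_summable_deriv_per_bernoulli[OF assms]]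
  have "has_summable_deriv
      (\<lambda>t. per_bernoulli (Suc j) (z - t) - (\<Sum>\<beta>=1..N. C \<beta> * per_bernoulli (Suc j) (h * real \<beta> - t)))
      (\<lambda>t. - per_bernoulli j (z - t) - (\<Sum>\<beta>=1..N. C \<beta> * - per_bernoulli j (h * real \<beta> - t)))"
    by (intro has_summable_deriv_diff has_summable_deriv_sum has_summable_deriv_scale R)
  then show ?thesis
    by (simp add: error_kernel_def[abs_def] error_functional_def sum_negf)
qed

lemma nth_summable_deriv_error_kernel:
  assumes "j \<ge> 1"
  shows "(has_summable_deriv ^^ n) (\<lambda>t. c * error_kernel (j + n) h N z C t)
    (\<lambda>t. c * ((-1) ^ n * error_kernel j h N z C t))"
  using assms
proof (induction n arbitrary: j)
  case (Suc n)
  have "has_summable_deriv (\<lambda>t. (c * (-1) ^ n) * error_kernel (Suc j) h N z C t)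
      (\<lambda>t. (c * (-1) ^ n) * - error_kernel j h N z C t)"
    by (intro has_summable_deriv_scale has_summable_deriv_error_kernel Suc.prems)
  then have "has_summable_deriv (\<lambda>t. c * ((-1) ^ n * error_kernel (Suc j) h N z C t))
      (\<lambda>t. c * ((-1) ^ Suc n * error_kernel j h N z C t))"
    by (simp add: mult.assoc)
  with Suc.IH[of "Suc j"] show ?case
    by (auto intro: relpowp_Suc_I)
qed simp

text \<open>The constant left over in \<open>per_bernoulli_1_representation\<close> is the same at z
  and at every node, so the condition on the sum of the coefficients cancels it.\<close>

lemma error_kernel_1_representation:
  assumes "has_summable_deriv u g" "u 1 = u 0" "z \<in> {0..1}"
    "\<And>\<beta>. \<beta> \<in> {1..N} \<Longrightarrow> h * real \<beta> \<in> {0..1}" "(\<Sum>\<beta>=1..N. C \<beta>) = 1"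
  shows "((\<lambda>t. g t * error_kernel 1 h N z C t) has_integral error_functional h N z C u) {0..1}"
proof -
  define c where "c = integral {0..1} (\<lambda>t. g t * t) - u 1"
  have "((\<lambda>t. g t * per_bernoulli 1 (z - t) - (\<Sum>\<beta>=1..N. C \<beta> * (g t * per_bernoulli 1 (h * real \<beta> - t))))
      has_integral (u z + c) - (\<Sum>\<beta>=1..N. C \<beta> * (u (h * real \<beta>) + c))) {0..1}"
    unfolding c_def using assms
    by (intro has_integral_diff has_integral_sum has_integral_mult_right
        per_bernoulli_1_representation) auto
  moreover have "(u z + c) - (\<Sum>\<beta>=1..N. C \<beta> * (u (h * real \<beta>) + c)) = error_functional h N z C u"
    using error_functional_add_const[OF assms(5), of h z u c] by (simp add: error_functional_def)
  moreover have "g t * per_bernoulli 1 (z - t) - (\<Sum>\<beta>=1..N. C \<beta> * (g t * per_bernoulli 1 (h *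
      real \<beta> - t)))
      = g t * error_kernel 1 h N z C t" for t
    by (simp add: error_kernel_def error_functional_def right_diff_distrib sum_distrib_left mult_ac)
  ultimately show ?thesis by simp
qed

lemma nth_summable_deriv_imp_continuous:
  assumes "(has_summable_deriv ^^ n) u g" "n > 0"
  shows "continuous_on S u"
proof -
  obtain k where "n = Suc k" using assms(2) gr0_implies_Suc by blast
  then obtain w where "has_summable_deriv u w"
    using assms(1) by (blast dest: relpowp_Suc_D2)
  then show ?thesis by (rule has_summable_deriv_imp_continuous)
qed

text \<open>Each integration by parts loses its boundary terms to periodicity, and no sign
  accumulates because the t-derivative of the kernel of order j + 1 is minus the kernel of order j.
  Periodicity is demanded only for n > 0: at n = 0 the function \<open>u\<close> is the top
  derivative, which need not be pointwise periodic.\<close>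

lemma error_kernel_chain:
  assumes "(has_summable_deriv ^^ n) u g" "n > 0 \<Longrightarrow> (\<And>x. u (x + 1) = u x)" "j \<ge> 1"
    "((\<lambda>t. u t * error_kernel j h N z C t) has_integral I) {0..1}"
  shows "((\<lambda>t. g t * error_kernel (j + n) h N z C t) has_integral I) {0..1}"
  using assms
proof (induction n arbitrary: u j)
  case (Suc n)
  obtain v where v: "has_summable_deriv u v" "(has_summable_deriv ^^ n) v g"
    using relpowp_Suc_D2[OF Suc.prems(1)] by blast
  have pu: "u (x + 1) = u x" for x using Suc.prems(2) by simp
  let ?G = "\<lambda>j. error_kernel j h N z C"
  note P = has_integral_by_parts_summable_deriv[OF v(1) has_summable_deriv_error_kernel[OF
      Suc.prems(3)], of 0 1 h N z C]
  have "?G (Suc j) 1 = ?G (Suc j) 0" "u 1 = u 0"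
    using error_kernel_periodic[of "Suc j" h N z C 0] pu[of 0] by simp_all
  then have "integral {0..1} (\<lambda>t. v t * ?G (Suc j) t) = integral {0..1} (\<lambda>t. u t * ?G j t)"
    using P(3) by simp
  then have "((\<lambda>t. v t * ?G (Suc j) t) has_integral I) {0..1}"
    using integral_unique[OF Suc.prems(4)] integrable_integral[OF
        set_lebesgue_integral_eq_integral(1)[OF P(1)]]
    by simp
  moreover have "v (x + 1) = v x" if "n > 0" for x
    by (rule has_summable_deriv_periodic[OF v(1) nth_summable_deriv_imp_continuous[OF v(2) that] pu])
  ultimately have "((\<lambda>t. g t * ?G (Suc j + n) t) has_integral I) {0..1}"
    by (intro Suc.IH[OF v(2)]) auto
  then show ?case by simp
qed simp

lemma error_functional_representation:
  assumes m: "m \<ge> 1" and g: "(has_summable_deriv ^^ m) \<phi> g" and per: "\<And>x. \<phi> (x + 1) = \<phi> x"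
    and nodes: "z \<in> {0..1}" "\<And>\<beta>. \<beta> \<in> {1..N} \<Longrightarrow> h * real \<beta> \<in> {0..1}" and C: "(\<Sum>\<beta>=1..N. C \<beta>) = 1"
  shows "((\<lambda>t. g t * error_kernel m h N z C t) has_integral error_functional h N z C \<phi>) {0..1}"
proof -
  obtain n where n: "m = Suc n" using m by (cases m) auto
  obtain u where u: "has_summable_deriv \<phi> u" "(has_summable_deriv ^^ n) u g"
    using relpowp_Suc_D2 g unfolding n by metis
  have "((\<lambda>t. u t * error_kernel 1 h N z C t) has_integral error_functional h N z C \<phi>) {0..1}"
    using per[of 0] by (intro error_kernel_1_representation u nodes C) auto
  moreover have "u (x + 1) = u x" if "n > 0" for x
    by (rule has_summable_deriv_periodic[OF u(1) nth_summable_deriv_imp_continuous[OF u(2) that] per])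
  ultimately have "((\<lambda>t. g t * error_kernel (1 + n) h N z C t) has_integral error_functional h N z C
      \<phi>) {0..1}"
    by (intro error_kernel_chain[OF u(2)]) auto
  then show ?thesis by (simp add: n)
qed

section \<open>Cauchy-Schwarz bound and extremal function\<close>

abbreviation kernel_energy :: "nat \<Rightarrow> real \<Rightarrow> nat \<Rightarrow> real \<Rightarrow> (nat \<Rightarrow> real) \<Rightarrow> real" where
  "kernel_energy j h N z C \<equiv> integral {0..1} (\<lambda>t. (error_kernel j h N z C t)\<^sup>2)"

lemma error_kernel_square_integrable:
  assumes "m \<ge> 1"
  shows "(\<lambda>t. (error_kernel m h N z C t)\<^sup>2) integrable_on {0..1}"
proof (cases "m = 1")
  case False
  then obtain j where j: "m = Suc j" "j \<ge> 1" using assms by (cases m) auto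
  show ?thesis unfolding j
    by (intro integrable_continuous_real continuous_intros
        has_summable_deriv_imp_continuous[OF has_summable_deriv_error_kernel[OF j(2)]])
next
  \<comment> \<open>The first-order kernel jumps at z and the nodes, so boundedness and
    measurability take the place of continuity.\<close>
  case True
  let ?G = "error_kernel 1 h N z C"
  have "(\<lambda>t. - ?G t) absolutely_integrable_on {0..1}"
    by (rule has_summable_derivD(1)[OF has_summable_deriv_error_kernel]) auto
  from set_integrable_mult_right[OF this, of "-1"] have ai: "?G absolutely_integrable_on {0..1}"
    by simp
  have b: "\<bar>per_bernoulli 1 x\<bar> \<le> 1" for x
    using frac_lt_1[of x] frac_ge_0[of x] unfolding per_bernoulli_def by (simp, linarith)
  have "\<bar>?G t\<bar> \<le> 1 + (\<Sum>\<beta>=1..N. \<bar>C \<beta>\<bar>)" for t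
  proof -
    have "\<bar>\<Sum>\<beta>=1..N. C \<beta> * per_bernoulli 1 (h * real \<beta> - t)\<bar> \<le> (\<Sum>\<beta>=1..N. \<bar>C \<beta>\<bar>)"
      by (rule sum_abs[THEN order_trans]) (auto intro!: sum_mono simp: abs_mult mult_left_le
          b[simplified])
    then show ?thesis
      unfolding error_kernel_def error_functional_def
      using b[of "z - t"] by linarith
  qed
  then have "bounded (?G ` {0..1})"
    by (auto simp: bounded_iff)
  moreover have "?G \<in> borel_measurable (lebesgue_on {0..1})"
    by (rule integrable_imp_measurable[OF set_lebesgue_integral_eq_integral(1)[OF ai]])
  ultimately have "(\<lambda>t. ?G t * ?G t) absolutely_integrable_on {0..1}"
    by (intro absolutely_integrable_bounded_measurable_product_real ai) auto
  then show ?thesis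
    unfolding True power2_eq_square by (rule set_lebesgue_integral_eq_integral(1))
qed

text \<open>Almost-everywhere uniqueness allows the norm to be computed from any explicit m-th
  derivative instead of the one picked by choice.\<close>

lemma per_sobolevI:
  assumes m: "m \<ge> 1" and g: "(has_summable_deriv ^^ m) \<phi> g" and per: "\<And>x. \<phi> (x + 1) = \<phi> x"
    and I: "((\<lambda>x. (g x)\<^sup>2) has_integral I) {0..1}"
  shows "\<phi> \<in> per_sobolev m" "per_sobolev_norm m \<phi> = sqrt I"
proof -
  obtain n where n: "m = Suc n" using m by (cases m) auto
  have g': "(has_summable_deriv ^^ m) \<phi> (nth_summable_deriv m \<phi>)"
    unfolding nth_summable_deriv_def by (rule someI[of "(has_summable_deriv ^^ m) \<phi>", OF g])
  have "negligible {x \<in> {0..1}. g x \<noteq> nth_summable_deriv m \<phi> x}"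
    using nth_summable_deriv_unique_AE g g' unfolding n by blast
  then have "((\<lambda>x. (nth_summable_deriv m \<phi> x)\<^sup>2) has_integral I) {0..1}"
    by (rule has_integral_spike[OF _ _ I]) auto
  then show "\<phi> \<in> per_sobolev m" "per_sobolev_norm m \<phi> = sqrt I"
    using per g by (auto simp: per_sobolev_def per_sobolev_norm_def)
qed

context
  fixes m N :: nat and h z :: real and C :: "nat \<Rightarrow> real"
  assumes m: "m \<ge> 1" and nodes: "z \<in> {0..1}" "\<And>\<beta>. \<beta> \<in> {1..N} \<Longrightarrow> h * real \<beta> \<in> {0..1}"
    and C: "(\<Sum>\<beta>=1..N. C \<beta>) = 1"
begin

lemma error_functional_bound:
  assumes \<phi>: "\<phi> \<in> per_sobolev m" "per_sobolev_norm m \<phi> = 1"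
  shows "(error_functional h N z C \<phi>)\<^sup>2 \<le> kernel_energy m h N z C"
proof -
  define g where "g = nth_summable_deriv m \<phi>"
  define l where "l = error_functional h N z C \<phi>"
  have g: "(has_summable_deriv ^^ m) \<phi> g"
  proof -
    obtain g0 where "(has_summable_deriv ^^ m) \<phi> g0"
      using \<phi>(1) unfolding per_sobolev_def by blast
    then show ?thesis
      unfolding g_def nth_summable_deriv_def by (rule someI[of "(has_summable_deriv ^^ m) \<phi>"])
  qed
  have g1: "((\<lambda>x. (g x)\<^sup>2) has_integral 1) {0..1}"
    using \<phi> integrable_integral[of "\<lambda>x. (g x)\<^sup>2" "{0..1}"]
    unfolding per_sobolev_def per_sobolev_norm_def g_def by auto
  have gG: "((\<lambda>t. g t * error_kernel m h N z C t) has_integral l) {0..1}"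
    unfolding l_def using \<phi>(1) by (intro error_functional_representation m g nodes C) (auto simp:
        per_sobolev_def)
  \<comment> \<open>Cauchy-Schwarz by projection: with G the kernel, integrate (G - l g)^2 >= 0,
    where g has unit square integral and the integral of g G is l.\<close>
  have "((\<lambda>t. (error_kernel m h N z C t)\<^sup>2 - (2 * l) * (g t * error_kernel m h N z C t) + l\<^sup>2 * (g t)\<^sup>2)
      has_integral kernel_energy m h N z C - (2 * l) * l + l\<^sup>2 * 1) {0..1}"
    by (intro has_integral_add has_integral_diff has_integral_mult_right gG g1
        integrable_integral error_kernel_square_integrable m)
  then have "0 \<le> kernel_energy m h N z C - (2 * l) * l + l\<^sup>2 * 1"
  proof (rule has_integral_nonneg)
    fix t
    have "(error_kernel m h N z C t)\<^sup>2 - (2 * l) * (g t * error_kernel m h N z C t) + l\<^sup>2 * (g t)\<^sup>2 =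
        (error_kernel m h N z C t - l * g t)\<^sup>2"
      by (simp add: power2_eq_square algebra_simps)
    then show "0 \<le> (error_kernel m h N z C t)\<^sup>2 - (2 * l) * (g t * error_kernel m h N z C t) + l\<^sup>2 *
        (g t)\<^sup>2"
      by simp
  qed
  then show ?thesis by (simp add: l_def power2_eq_square)
qed

text \<open>Every t-derivative of a kernel contributes a sign, so the factor \<open>(-1) ^ m\<close>
  makes c times the kernel of order m the m-th derivative of \<psi> c. Proportionality to the
  representer is the equality case of Cauchy-Schwarz. The scalar c serves normalisation as well as
  \<open>kernel_energy_eq\<close>, where c = 1.\<close>

lemma extremal_function:
  defines "\<psi> \<equiv> \<lambda>c t. (c * (-1) ^ m) * error_kernel (m + m) h N z C t"
  shows "\<psi> c \<in> per_sobolev m" "per_sobolev_norm m (\<psi> c) = \<bar>c\<bar> * sqrt (kernel_energy m h N z C)"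
    "error_functional h N z C (\<psi> c) = c * kernel_energy m h N z C"
proof -
  have D: "(has_summable_deriv ^^ m) (\<psi> c) (\<lambda>t. c * error_kernel m h N z C t)"
    using nth_summable_deriv_error_kernel[OF m, of m "c * (-1) ^ m" h N z C]
    by (simp add: \<psi>_def mult.assoc)
  have per: "\<psi> c (x + 1) = \<psi> c x" for x
    by (simp add: \<psi>_def error_kernel_periodic)
  note E = integrable_integral[OF error_kernel_square_integrable[OF m, of h N z C]]
  have I: "((\<lambda>t. (c * error_kernel m h N z C t)\<^sup>2) has_integral c\<^sup>2 * kernel_energy m h N z C) {0..1}"
    using has_integral_mult_right[OF E] by (simp add: power_mult_distrib)
  show "\<psi> c \<in> per_sobolev m" "per_sobolev_norm m (\<psi> c) = \<bar>c\<bar> * sqrt (kernel_energy m h N z C)"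
    using per_sobolevI[OF m D per I] by (simp_all add: real_sqrt_mult)
  have "((\<lambda>t. c * error_kernel m h N z C t * error_kernel m h N z C t) has_integral
      error_functional h N z C (\<psi> c)) {0..1}"
    by (rule error_functional_representation[OF m D per nodes C])
  moreover have "((\<lambda>t. c * error_kernel m h N z C t * error_kernel m h N z C t) has_integral c *
      kernel_energy m h N z C) {0..1}"
    using has_integral_mult_right[OF E, of c] by (simp add: power2_eq_square mult.assoc)
  ultimately show "error_functional h N z C (\<psi> c) = c * kernel_energy m h N z C"
    by (rule has_integral_unique)
qed

text \<open>The unit sphere has to be known nonempty, since a supremum over the empty set of reals
  is unspecified. When the energy vanishes, as it can when z is a node, the extremal function cannot
  be normalised to supply an element.\<close>

lemma dual_norm_error_functional:
  assumes "\<exists>\<phi>\<in>per_sobolev m. per_sobolev_norm m \<phi> = 1"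
  shows "dual_norm m (error_functional h N z C) = sqrt (kernel_energy m h N z C)"
proof -
  let ?S = "{\<phi> \<in> per_sobolev m. per_sobolev_norm m \<phi> = 1}"
  have E: "kernel_energy m h N z C \<ge> 0"
      by (rule integral_nonneg[OF error_kernel_square_integrable[OF m]]) simp
  have ub: "\<bar>error_functional h N z C \<phi>\<bar> \<le> sqrt (kernel_energy m h N z C)" if "\<phi> \<in> ?S" for \<phi>
    using real_sqrt_le_mono[OF error_functional_bound, of \<phi>] that by simp
  show ?thesis
    unfolding dual_norm_def
  proof (rule antisym)
    show "(SUP \<phi>\<in>?S. \<bar>error_functional h N z C \<phi>\<bar>) \<le> sqrt (kernel_energy m h N z C)"
      using assms by (intro cSUP_least ub) auto
    have bdd: "bdd_above ((\<lambda>\<phi>. \<bar>error_functional h N z C \<phi>\<bar>) ` ?S)"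
      by (rule bdd_aboveI2[OF ub])
    show "sqrt (kernel_energy m h N z C) \<le> (SUP \<phi>\<in>?S. \<bar>error_functional h N z C \<phi>\<bar>)"
    proof (cases "kernel_energy m h N z C = 0")
      case True
      obtain \<phi> where \<phi>: "\<phi> \<in> ?S" using assms by blast
      show ?thesis
        by (rule cSUP_upper2[OF bdd \<phi>]) (simp add: True)
    next
      case False
      with E have pos: "kernel_energy m h N z C > 0" by simp
      let ?\<psi> = "\<lambda>t. (1 / sqrt (kernel_energy m h N z C) * (-1) ^ m) * error_kernel (m + m) h N z C t"
      have "?\<psi> \<in> ?S"
        using extremal_function(1,2)[of "1 / sqrt (kernel_energy m h N z C)"] pos by simp
      then show ?thesis
      proof (rule cSUP_upper2[OF bdd])
        show "sqrt (kernel_energy m h N z C) \<le> \<bar>error_functional h N z C ?\<psi>\<bar>"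
          unfolding extremal_function(3) using pos by (simp add: real_div_sqrt)
      qed
    qed
  qed
qed

lemma unit_sphere_nonempty:
  assumes "kernel_energy m h N z C > 0"
  shows "\<exists>\<phi>\<in>per_sobolev m. per_sobolev_norm m \<phi> = 1"
proof (rule bexI)
  show "per_sobolev_norm m (\<lambda>t. (1 / sqrt (kernel_energy m h N z C) * (-1) ^ m) * error_kernel (m +
      m) h N z C t) = 1"
    unfolding extremal_function(2) using assms by simp
qed (rule extremal_function(1))

text \<open>This replaces Parseval: the energy becomes a combination of point values of the kernel
  of order 2m.\<close>

lemma kernel_energy_eq: "kernel_energy m h N z C =
    (-1) ^ m * error_functional h N z C (error_kernel (m + m) h N z C)"
  using extremal_function(3)[of 1]
  unfolding error_functional_scale by simp

end

section \<open>Fourier series of the norm\<close>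

lemma has_sum_minus:
  fixes f g :: "'a \<Rightarrow> 'b :: real_normed_vector"
  assumes "(f has_sum a) A" "(g has_sum b) A"
  shows "((\<lambda>x. f x - g x) has_sum (a - b)) A"
  using has_sum_add[OF assms(1), of "\<lambda>x. - g x" "- b"] assms(2) by (simp add: has_sum_uminus)

lemma has_sum_sum_finite:
  fixes f :: "'i \<Rightarrow> 'a \<Rightarrow> 'b :: real_normed_vector"
  assumes "\<And>i. i \<in> I \<Longrightarrow> (f i has_sum a i) A"
  shows "((\<lambda>x. \<Sum>i\<in>I. f i x) has_sum (\<Sum>i\<in>I. a i)) A"
  using assms by (induction I rule: infinite_finite_induct) (auto intro!: has_sum_add)

text \<open>Since \<open>x / 0 = 0\<close>, the weight vanishes at \<open>k = 0\<close> for \<open>m \<ge> 1\<close>, so sums over \<open>k \<noteq> 0\<close> may be taken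
  over all integers.\<close>
definition fourier_weight :: "nat \<Rightarrow> int \<Rightarrow> real" where
  "fourier_weight m k = 1 / (2 * pi * of_int k) ^ (2 * m)"

lemma fourier_weight_nonneg: "fourier_weight m k \<ge> 0"
  by (simp add: fourier_weight_def)

lemma fourier_weight_minus: "fourier_weight m (- k) = fourier_weight m k"
  by (simp add: fourier_weight_def)

lemma fourier_weight_pos: "k \<noteq> 0 \<Longrightarrow> fourier_weight m k > 0"
  by (simp add: fourier_weight_def zero_less_power_eq)

lemma even_per_bernoulli_term:
  "(-1) ^ m * per_bernoulli_term (2 * m) n x =
     2 * fourier_weight m (int (Suc n)) * cos (2 * pi * real (Suc n) * x)"
proof -
  have "real (2 * m) * (pi / 2) = real m * pi" by simp
  then have "cos (2 * pi * real (Suc n) * x - real (2 * m) * (pi / 2)) =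
      (-1) ^ m * cos (2 * pi * real (Suc n) * x)"
    by (simp only: cos_diff cos_npi sin_npi) (simp only: mult_zero_right add_0_right mult.commute)
  then show ?thesis
    unfolding per_bernoulli_term_def fourier_weight_def by (simp del: of_nat_Suc)
qed

text \<open>Two-sided form of the cosine series: the negative modes are the conjugates of the
  positive ones, and absolute convergence at order 2m >= 2 permits an unordered sum.\<close>

lemma per_bernoulli_fourier_series:
  assumes m: "m \<ge> 1"
  shows "((\<lambda>k::int. of_real (fourier_weight m k) * cis (2 * pi * of_int k * x)) has_sum
    of_real ((-1) ^ m * per_bernoulli (2 * m) x)) UNIV"
proof -
  define f where "f k = of_real (fourier_weight m k) * cis (2 * pi * of_int k * x)" for k :: int
  define P where "P = suminf (\<lambda>n. f (int (Suc n)))"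
  have nw: "norm (f (int (Suc n))) \<le> 2 * inverse (real (Suc n) ^ (2 * m))" for n
  proof -
    have "norm (f (int (Suc n))) = 1 / (2 * pi * real (Suc n)) ^ (2 * m)"
    proof -
      have "norm (f (int (Suc n))) = fourier_weight m (int (Suc n))"
        by (simp only: f_def norm_mult norm_of_real norm_cis abs_of_nonneg[OF fourier_weight_nonneg]
            mult_1_right)
      then show ?thesis by (simp add: fourier_weight_def del: of_nat_Suc)
    qed
    also have "\<dots> \<le> 1 / real (Suc n) ^ (2 * m)"
      using pi_gt3 by (intro divide_left_mono power_mono mult_pos_pos zero_less_power) auto
    also have "\<dots> \<le> 2 * inverse (real (Suc n) ^ (2 * m))"
      by (simp add: divide_inverse)
    finally show ?thesis .
  qed
  have sn: "summable (\<lambda>n. norm (f (int (Suc n))))"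
    by (rule summable_comparison_test'[OF summable_per_bernoulli_bound[of "2 * m"]])
       (use m nw in auto)
  have "(\<lambda>n. f (int (Suc n))) sums P"
    unfolding P_def by (rule summable_sums[OF summable_norm_cancel[OF sn]])
  then have hs: "((\<lambda>n. f (int (Suc n))) has_sum P) UNIV"
    by (rule norm_summable_imp_has_sum[OF sn])
  have pos: "(f has_sum P) {0<..}"
    by (rule has_sum_reindex_bij_witness[THEN iffD1, OF _ _ _ _ _ _ hs,
          of "\<lambda>k. nat k - 1" "\<lambda>n. int (Suc n)"]) auto
  have fm: "f (- k) = cnj (f k)" for k
    by (simp add: f_def fourier_weight_minus cis_cnj)
  have "((\<lambda>k. cnj (f k)) has_sum cnj P) {0<..}"
    using pos by simp
  then have neg: "(f has_sum cnj P) {..<0}"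
    by (rule has_sum_reindex_bij_witness[THEN iffD1, rotated -1, of _ _ _ uminus uminus]) (auto simp
        flip: fm)
  have "(f has_sum 0) {0}"
    by (rule has_sum_finiteI) (use m in \<open>auto simp: f_def fourier_weight_def\<close>)
  then have "(f has_sum 0 + (P + cnj P)) ({0} \<union> ({0<..} \<union> {..<0}))"
    by (intro has_sum_Un_disjoint pos neg) auto
  moreover have "{0} \<union> ({0<..} \<union> {..<0}) = (UNIV :: int set)" by auto
  moreover have "P + cnj P = of_real (2 * Re P)" by (simp add: complex_add_cnj)
  moreover have "2 * Re P = (-1) ^ m * per_bernoulli (2 * m) x"
  proof -
    have "(\<lambda>n. 2 * Re (f (int (Suc n)))) sums (2 * Re P)"
      by (intro sums_mult sums_Re) fact
    moreover have "2 * Re (f (int (Suc n))) = (-1) ^ m * per_bernoulli_term (2 * m) n x" for n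
      unfolding even_per_bernoulli_term f_def by (simp del: of_nat_Suc)
    ultimately have s: "(\<lambda>n. (-1) ^ m * per_bernoulli_term (2 * m) n x) sums (2 * Re P)" by simp
    from sums_mult[OF this, of "(-1) ^ m"]
    have "(\<lambda>n. per_bernoulli_term (2 * m) n x) sums ((-1) ^ m * (2 * Re P))"
      by simp
    then have "per_bernoulli (2 * m) x = (-1) ^ m * (2 * Re P)"
      using m by (simp add: per_bernoulli_def sums_iff)
    then show ?thesis by simp
  qed
  ultimately have "(f has_sum of_real ((-1) ^ m * per_bernoulli (2 * m) x)) UNIV"
    by (simp only: add_0_left)
  then show ?thesis by (simp only: f_def[abs_def])
qed

lemma fourier_weight_summable:
  assumes "m \<ge> 1"
  shows "fourier_weight m summable_on A"
proof -
  have "(fourier_weight m has_sum Re (of_real ((-1) ^ m * per_bernoulli (2 * m) 0))) UNIV"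
    using has_sum_Re[OF per_bernoulli_fourier_series[OF assms, of 0]] by simp
  then show ?thesis
    using has_sum_imp_summable summable_on_subset_banach by blast
qed

text \<open>The error functional evaluated at the exponential with frequency k, spelled out because
  \<open>error_functional\<close> accepts real functions only.\<close>

definition error_coeff :: "real \<Rightarrow> nat \<Rightarrow> real \<Rightarrow> (nat \<Rightarrow> real) \<Rightarrow> int \<Rightarrow> complex" where
  "error_coeff h N z C k =
     cis (2 * pi * of_int k * z) - (\<Sum>\<beta>=1..N. of_real (C \<beta>) * cis (2 * pi * of_int k * (h * real \<beta>)))"

lemma error_kernel_fourier_series:
  assumes m: "m \<ge> 1"
  shows "((\<lambda>k. of_real (fourier_weight m k) * (cis (- (2 * pi * of_int k * t)) * error_coeff h N z C
      k)) has_sum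
    of_real ((-1) ^ m * error_kernel (2 * m) h N z C t)) UNIV"
proof -
  let ?s = "\<lambda>x k. of_real (fourier_weight m k) * cis (2 * pi * of_int k * (x - t))"
  have "((\<lambda>k. ?s z k - (\<Sum>\<beta>=1..N. of_real (C \<beta>) * ?s (h * real \<beta>) k)) has_sum
     of_real ((-1) ^ m * per_bernoulli (2 * m) (z - t)) -
      (\<Sum>\<beta>=1..N. of_real (C \<beta>) * of_real ((-1) ^ m * per_bernoulli (2 * m) (h * real \<beta> - t)))) UNIV"
    by (intro has_sum_minus has_sum_sum_finite has_sum_cmult_right per_bernoulli_fourier_series m)
  moreover have "of_real ((-1) ^ m * per_bernoulli (2 * m) (z - t)) -
      (\<Sum>\<beta>=1..N. of_real (C \<beta>) * of_real ((-1) ^ m * per_bernoulli (2 * m) (h * real \<beta> - t)))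
     = complex_of_real ((-1) ^ m * error_kernel (2 * m) h N z C t)"
    by (simp add: error_kernel_def error_functional_def right_diff_distrib sum_distrib_left mult_ac)
  moreover have "?s z k - (\<Sum>\<beta>=1..N. of_real (C \<beta>) * ?s (h * real \<beta>) k) =
      of_real (fourier_weight m k) * (cis (- (2 * pi * of_int k * t)) * error_coeff h N z C k)" for k
  proof -
    have c: "cis (2 * pi * of_int k * (x - t)) = cis (- (2 * pi * of_int k * t)) * cis (2 * pi *
        of_int k * x)" for x
      by (simp add: cis_mult algebra_simps)
    show ?thesis
      unfolding c error_coeff_def by (simp add: right_diff_distrib sum_distrib_left mult_ac)
  qed
  ultimately show ?thesis by simp
qed

text \<open>One application of the functional, inside the kernel, yields \<open>error_coeff\<close>;
  the second, in the variable t with frequency -k, yields its conjugate. Their product is the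
  squared modulus.\<close>

lemma kernel_energy_has_sum:
  assumes m: "m \<ge> 1" and nodes: "z \<in> {0..1}" "\<And>\<beta>. \<beta> \<in> {1..N} \<Longrightarrow> h * real \<beta> \<in> {0..1}"
    and C: "(\<Sum>\<beta>=1..N. C \<beta>) = 1"
  shows "((\<lambda>k. fourier_weight m k * (cmod (error_coeff h N z C k))\<^sup>2) has_sum
      kernel_energy m h N z C) UNIV"
proof -
  let ?E = "error_coeff h N z C" and ?K = "error_kernel (2 * m) h N z C"
  let ?s = "\<lambda>t k. of_real (fourier_weight m k) * (cis (- (2 * pi * of_int k * t)) * ?E k)"
  have "((\<lambda>k. ?s z k - (\<Sum>\<beta>=1..N. of_real (C \<beta>) * ?s (h * real \<beta>) k)) has_sum
     of_real ((-1) ^ m * ?K z) - (\<Sum>\<beta>=1..N. of_real (C \<beta>) * of_real ((-1) ^ m * ?K (h * real \<beta>)))) UNIV"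
    by (intro has_sum_minus has_sum_sum_finite has_sum_cmult_right error_kernel_fourier_series m)
  moreover have "of_real ((-1) ^ m * ?K z) - (\<Sum>\<beta>=1..N. of_real (C \<beta>) * of_real ((-1) ^ m * ?K (h *
      real \<beta>)))
     = complex_of_real (kernel_energy m h N z C)"
  proof -
    have "kernel_energy m h N z C = (-1) ^ m * error_functional h N z C ?K"
      using kernel_energy_eq[OF assms] by (simp only: mult_2)
    then show ?thesis
      by (simp only: error_functional_def of_real_diff of_real_sum of_real_mult right_diff_distrib
          sum_distrib_left mult.left_commute)
  qed
  moreover have "?s z k - (\<Sum>\<beta>=1..N. of_real (C \<beta>) * ?s (h * real \<beta>) k) =
      of_real (fourier_weight m k * (cmod (?E k))\<^sup>2)" for k
  proof -
    have "?s z k - (\<Sum>\<beta>=1..N. of_real (C \<beta>) * ?s (h * real \<beta>) k) = of_real (fourier_weight m k) * (?E k *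
        (cis (- (2 * pi * of_int k * z)) - (\<Sum>\<beta>=1..N. of_real (C \<beta>) * cis (- (2 * pi * of_int k *
            (h * real \<beta>))))))"
      by (simp add: right_diff_distrib sum_distrib_left mult_ac)
    also have "cis (- (2 * pi * of_int k * z)) - (\<Sum>\<beta>=1..N. of_real (C \<beta>) * cis (- (2 * pi *
        of_int k * (h * real \<beta>)))) = cnj (?E k)"
      by (simp add: error_coeff_def cis_cnj)
    finally show ?thesis by (simp only: of_real_mult complex_norm_square)
  qed
  ultimately have "((\<lambda>k. complex_of_real (fourier_weight m k * (cmod (?E k))\<^sup>2)) has_sum
      complex_of_real (kernel_energy m h N z C)) UNIV" by simp
  then show ?thesis by (simp only: has_sum_of_real_iff)
qed

text \<open>One node at 1 with coefficient 1 and z = 1/2 gives the coefficient cis pi - 1 = -2 at k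
  = 1, hence positive energy. The space does not involve N or z, so one configuration settles
  all.\<close>

lemma per_sobolev_unit_sphere_nonempty:
  assumes m: "m \<ge> 1"
  shows "\<exists>\<phi>\<in>per_sobolev m. per_sobolev_norm m \<phi> = 1"
proof (rule unit_sphere_nonempty[of m "1/2" 1 1 "\<lambda>_. 1"])
  have "((\<lambda>k. fourier_weight m k * (cmod (error_coeff 1 1 (1/2) (\<lambda>_. 1) k))\<^sup>2) has_sum
      kernel_energy m 1 1 (1/2) (\<lambda>_. 1)) UNIV"
    by (rule kernel_energy_has_sum[OF m]) auto
  then have "(\<Sum>k\<in>{1}. fourier_weight m k * (cmod (error_coeff 1 1 (1/2) (\<lambda>_. 1) k))\<^sup>2) \<le>
      kernel_energy m 1 1 (1/2) (\<lambda>_. 1)"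
    by (rule finite_sum_le_has_sum) (auto intro: mult_nonneg_nonneg fourier_weight_nonneg)
  moreover have "error_coeff 1 1 (1/2) (\<lambda>_. 1) 1 = -2"
    by (simp add: error_coeff_def cis_pi)
  ultimately show "kernel_energy m 1 1 (1/2) (\<lambda>_. 1) > 0"
    using fourier_weight_pos[of 1 m] by simp
qed (use m in auto)

lemma dual_norm_error_functional_square:
  assumes m: "m \<ge> 1" and nodes: "z \<in> {0..1}" "\<And>\<beta>. \<beta> \<in> {1..N} \<Longrightarrow> h * real \<beta> \<in> {0..1}"
    and C: "(\<Sum>\<beta>=1..N. C \<beta>) = 1"
  shows "((\<lambda>k. fourier_weight m k * (cmod (error_coeff h N z C k))\<^sup>2) has_sum
      (dual_norm m (error_functional h N z C))\<^sup>2) UNIV" "dual_norm m (error_functional h N z C) \<ge> 0"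
proof -
  have "kernel_energy m h N z C \<ge> 0"
    by (rule has_sum_nonneg[OF kernel_energy_has_sum[OF assms]]) (auto intro: mult_nonneg_nonneg
        fourier_weight_nonneg)
  then show "((\<lambda>k. fourier_weight m k * (cmod (error_coeff h N z C k))\<^sup>2) has_sum
      (dual_norm m (error_functional h N z C))\<^sup>2) UNIV" "dual_norm m (error_functional h N z C) \<ge> 0"
    using kernel_energy_has_sum[OF assms]
      dual_norm_error_functional[OF assms per_sobolev_unit_sphere_nonempty[OF m]]
    by (simp_all only: real_sqrt_pow2 real_sqrt_ge_0_iff)
qed

section \<open>Residue classes and the discrete Fourier transform\<close>

lemma residue_class_summable:
  fixes f :: "int \<Rightarrow> 'a :: banach"
  assumes "f summable_on UNIV" "N > 0"
  shows "(\<lambda>t. f (j + t * int N)) summable_on UNIV"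
proof -
  have "inj (\<lambda>t. j + t * int N)" using assms(2) by (auto intro: injI)
  moreover have "f summable_on range (\<lambda>t. j + t * int N)"
    by (rule summable_on_subset_banach[OF assms(1)]) simp
  ultimately show ?thesis
    by (subst (asm) summable_on_reindex) (simp_all add: o_def)
qed

lemma infsum_residue_classes:
  fixes f :: "int \<Rightarrow> 'a :: banach"
  assumes f: "f summable_on UNIV" and N: "N > 0"
  shows "infsum f UNIV = (\<Sum>j\<in>{0..<int N}. \<Sum>\<^sub>\<infinity>t\<in>UNIV. f (j + t * int N))"
proof -
  let ?g = "\<lambda>(j, t). j + t * int N"
  have bij: "bij_betw ?g ({0..<int N} \<times> UNIV) UNIV"
    by (rule bij_betw_byWitness[where f' = "\<lambda>k. (k mod int N, k div int N)"]) (use N in auto)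
  have "(\<lambda>x. f (?g x)) summable_on ({0..<int N} \<times> UNIV)"
    using summable_on_reindex_bij_betw[OF bij, of f] f by simp
  then have "infsum (\<lambda>j. \<Sum>\<^sub>\<infinity>t\<in>UNIV. f (j + t * int N)) {0..<int N} =
      infsum (\<lambda>(j, t). f (j + t * int N)) ({0..<int N} \<times> UNIV)"
    by (intro infsum_Sigma'_banach) (simp add: case_prod_unfold)
  also have "\<dots> = infsum f UNIV"
    using infsum_reindex_bij_betw[OF bij, of f] by (simp add: case_prod_unfold)
  finally show ?thesis by simp
qed

lemma infsum_int_reflect: "infsum (\<lambda>t::int. f (- t)) UNIV = infsum f UNIV"
  by (rule infsum_reindex_bij_betw) (rule bij_uminus)

lemma infsum_int_shift: "infsum (\<lambda>t::int. f (t + c)) UNIV = infsum f UNIV"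
  by (rule infsum_reindex_bij_betw) (rule bij_betw_byWitness[where f' = "\<lambda>t. t - c"], auto)

text \<open>Completing the square in d: the weighted mean S/W of the unit vectors is the minimiser,
  and since these have modulus 1 the minimum is W - |S|^2/W.\<close>

lemma weighted_square_deviation:
  fixes w :: "'a \<Rightarrow> real" and u :: "'a \<Rightarrow> complex"
  assumes w: "(w has_sum W) A" and S: "((\<lambda>t. of_real (w t) * u t) has_sum S) A"
    and u: "\<And>t. t \<in> A \<Longrightarrow> cmod (u t) = 1" and W: "W > 0"
  shows "((\<lambda>t. w t * (cmod (u t - d))\<^sup>2) has_sum
      (W - (cmod S)\<^sup>2 / W + W * (cmod (d - S / of_real W))\<^sup>2)) A"
proof -
  have "((\<lambda>t. (1 + (cmod d)\<^sup>2) * w t - (2 * Re d * Re (of_real (w t) * u t) + 2 * Im d *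
      Im (of_real (w t) * u t))) has_sum
     ((1 + (cmod d)\<^sup>2) * W - (2 * Re d * Re S + 2 * Im d * Im S))) A"
    by (intro has_sum_minus has_sum_add has_sum_cmult_right w has_sum_Re has_sum_Im S)
  moreover have "(1 + (cmod d)\<^sup>2) * W - (2 * Re d * Re S + 2 * Im d * Im S) =
      W - (cmod S)\<^sup>2 / W + W * (cmod (d - S / of_real W))\<^sup>2"
  proof -
    define p where "p = S / of_real W"
    have S': "S = of_real W * p" using W by (simp add: p_def)
    have "(cmod S)\<^sup>2 / W = W * (cmod p)\<^sup>2"
      using W by (simp add: S' norm_mult power_mult_distrib power2_eq_square)
    moreover have "Re S = W * Re p" "Im S = W * Im p" by (simp_all add: S')
    ultimately show ?thesis
      unfolding p_def[symmetric] by (simp only:) (simp add: cmod_power2 power2_diff algebra_simps)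
  qed
  moreover have "(1 + (cmod d)\<^sup>2) * w t - (2 * Re d * Re (of_real (w t) * u t) + 2 * Im d *
      Im (of_real (w t) * u t)) =
      w t * (cmod (u t - d))\<^sup>2" if "t \<in> A" for t
  proof -
    have "(Re (u t))\<^sup>2 + (Im (u t))\<^sup>2 = 1"
      using u[OF that] by (simp add: cmod_def)
    then have "(cmod (u t - d))\<^sup>2 = 1 + (cmod d)\<^sup>2 - 2 * Re d * Re (u t) - 2 * Im d * Im (u t)"
      by (simp add: cmod_power2 power2_diff algebra_simps)
    then show ?thesis by (simp only:) (simp add: algebra_simps)
  qed
  ultimately show ?thesis
    using has_sum_cong[of A _ "\<lambda>t. w t * (cmod (u t - d))\<^sup>2"] by (metis (no_types, lifting))
qed

lemma sum_roots_of_unity: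
  assumes N: "N > 0"
  shows "(\<Sum>\<beta>=1..N. cis (2 * pi * of_int k * (real \<beta> / real N))) = (if int N dvd k then of_nat N else 0)"
proof -
  define x where "x = cis (2 * pi * of_int k / real N)"
  have xp: "cis (2 * pi * of_int k * (real \<beta> / real N)) = x ^ \<beta>" for \<beta>
    by (simp add: x_def Complex.DeMoivre mult_ac)
  have xN: "x ^ N = 1"
  proof -
    have "real N * (2 * pi * of_int k / real N) = 2 * pi * of_int k" using N by simp
    then have "x ^ N = cis (2 * pi * of_int k)" by (simp only: x_def Complex.DeMoivre)
    then show ?thesis by simp
  qed
  have "x = 1 \<longleftrightarrow> int N dvd k"
  proof
    assume "x = 1"
    then have "cos (2 * pi * of_int k / real N) = 1"
      by (simp add: x_def complex_eq_iff)
    then obtain n :: int where "2 * pi * of_int k / real N = of_int n * 2 * pi"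
      by (auto simp: cos_one_2pi_int)
    then have "real_of_int k = real_of_int (n * int N)"
      using N by (simp add: field_simps)
    then have "k = n * int N" by (simp only: of_int_eq_iff)
    then show "int N dvd k" by simp
  next
    assume "int N dvd k"
    then obtain n where "k = int N * n" by auto
    then have "2 * pi * of_int k / real N = 2 * pi * of_int n" using N by simp
    then show "x = 1" by (simp add: x_def)
  qed
  moreover have "(\<Sum>\<beta>=1..N. x ^ \<beta>) = 0" if "x \<noteq> 1"
  proof -
    have "(\<Sum>\<beta>=1..N. x ^ \<beta>) = x * (\<Sum>\<beta><N. x ^ \<beta>)"
      by (simp add: sum_distrib_left sum.atLeast1_atMost_eq)
    also have "(\<Sum>\<beta><N. x ^ \<beta>) = 0"
      using geometric_sum[OF that, of N] xN by simp
    finally show ?thesis by simp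
  qed
  ultimately show ?thesis unfolding xp by (cases "x = 1") auto
qed

text \<open>The Hermitian symmetry of \<open>c\<close> makes the coefficients real.\<close>
lemma discrete_fourier_interpolation:
  fixes c :: "int \<Rightarrow> complex"
  assumes N: "N > 0" and per: "\<And>k t. c (k + t * int N) = c k" and herm: "\<And>k. c (- k) = cnj (c k)"
  obtains C :: "nat \<Rightarrow> real"
  where "\<And>l. (\<Sum>\<beta>=1..N. of_real (C \<beta>) * cis (2 * pi * of_int l * (real \<beta> / real N))) = c l"
proof
  define E where "E k \<beta> = cis (2 * pi * of_int k * (real \<beta> / real N))" for k :: int and \<beta> :: nat
  \<comment> \<open>Real part of the inverse discrete Fourier transform. In the transform of C the
    halves coming from c j and cnj (c j) contribute c l / 2 each.\<close>
  define C where "C \<beta> = (\<Sum>j\<in>{0..<int N}. Re (c j * E (- j) \<beta>)) / real N" for \<beta>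
  have per': "c (k mod int N) = c k" for k
    using per[of "k mod int N" "k div int N"] by (simp add: add.commute)
  have Em: "E j \<beta> * E k \<beta> = E (j + k) \<beta>" for j k \<beta>
    by (simp add: E_def cis_mult algebra_simps)
  have Ec: "cnj (E k \<beta>) = E (- k) \<beta>" for k \<beta>
    by (simp add: E_def cis_cnj)
  have ES: "(\<Sum>\<beta>=1..N. E k \<beta>) = (if int N dvd k then of_nat N else 0)" for k
    unfolding E_def by (rule sum_roots_of_unity[OF N])
  have sel: "(\<Sum>j\<in>{0..<int N}. f j * (if int N dvd l - j then of_nat N else 0)) =
      f (l mod int N) * of_nat N"
    for f :: "int \<Rightarrow> complex" and l
  proof -
    have "int N dvd l - j \<longleftrightarrow> j = l mod int N" if "j \<in> {0..<int N}" for j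
      using that by (auto simp: mod_eq_dvd_iff[symmetric])
    then have "(\<Sum>j\<in>{0..<int N}. f j * (if int N dvd l - j then of_nat N else 0)) =
        (\<Sum>j\<in>{0..<int N}. if j = l mod int N then f j * of_nat N else 0)"
      by (intro sum.cong) auto
    also have "\<dots> = f (l mod int N) * of_nat N"
      using N by (subst sum.delta) auto
    finally show ?thesis .
  qed
  fix l :: int
  have re: "complex_of_real (Re x) = (x + cnj x) / 2" for x
    by (simp add: complex_eq_iff)
  have "of_real (C \<beta>) * E l \<beta> =
      (\<Sum>j\<in>{0..<int N}. c j * E (l - j) \<beta> + cnj (c j) * E (l + j) \<beta>) / (2 * of_nat N)" for \<beta>
  proof -
    have "of_real (Re (c j * E (- j) \<beta>)) * E l \<beta> = (c j * E (l - j) \<beta> + cnj (c j) * E (l +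
        j) \<beta>) / 2" for j
    proof -
      have "(c j * E (- j) \<beta> + cnj (c j) * E j \<beta>) * E l \<beta> = c j * (E l \<beta> * E (- j) \<beta>) + cnj (c j) *
          (E l \<beta> * E j \<beta>)"
        by (simp add: algebra_simps)
      then show ?thesis
        unfolding re by (simp add: Ec Em)
    qed
    note half = this
    have "of_real (C \<beta>) * E l \<beta> = (\<Sum>j\<in>{0..<int N}. of_real (Re (c j * E (- j) \<beta>)) * E l \<beta>) / of_nat N"
      by (simp only: C_def of_real_divide of_real_sum of_real_of_nat_eq times_divide_eq_left
          sum_distrib_right)
    also have "\<dots> = (\<Sum>j\<in>{0..<int N}. c j * E (l - j) \<beta> + cnj (c j) * E (l + j) \<beta>) / 2 / of_nat N"
      by (simp only: half sum_divide_distrib)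
    finally show ?thesis by simp
  qed
  then have "(\<Sum>\<beta>=1..N. of_real (C \<beta>) * E l \<beta>) =
      (\<Sum>\<beta>=1..N. \<Sum>j\<in>{0..<int N}. c j * E (l - j) \<beta> + cnj (c j) * E (l + j) \<beta>) / (2 * of_nat N)"
    by (simp add: sum_divide_distrib)
  also have "(\<Sum>\<beta>=1..N. \<Sum>j\<in>{0..<int N}. c j * E (l - j) \<beta> + cnj (c j) * E (l + j) \<beta>) =
      (\<Sum>j\<in>{0..<int N}. c j * (\<Sum>\<beta>=1..N. E (l - j) \<beta>)) + (\<Sum>j\<in>{0..<int N}. cnj (c j) * (\<Sum>\<beta>=1..N. E (l +
          j) \<beta>))"
    by (subst sum.swap) (simp add: sum.distrib sum_distrib_left)
  also have "(\<Sum>j\<in>{0..<int N}. c j * (\<Sum>\<beta>=1..N. E (l - j) \<beta>)) = c l * of_nat N"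
    unfolding ES sel per' ..
  \<comment> \<open>The conjugate half selects the class of -l, and Hermitian symmetry turns cnj (c
    (- l)) back into c l.\<close>
  also have "(\<Sum>j\<in>{0..<int N}. cnj (c j) * (\<Sum>\<beta>=1..N. E (l + j) \<beta>)) =
      (\<Sum>j\<in>{0..<int N}. cnj (c j) * (if int N dvd (- l) - j then of_nat N else 0))"
  proof -
    have "int N dvd l + j \<longleftrightarrow> int N dvd - l - j" for j
      using dvd_minus_iff[of "int N" "l + j"] by simp
    then show ?thesis unfolding ES by simp
  qed
  also have "\<dots> = c l * of_nat N"
    unfolding sel per' herm by simp
  also have "(c l * of_nat N + c l * of_nat N) / (2 * of_nat N) = c l"
    using N by simp
  finally show "(\<Sum>\<beta>=1..N. of_real (C \<beta>) * cis (2 * pi * of_int l * (real \<beta> / real N))) = c l"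
    by (simp only: E_def)
qed

section \<open>The optimal coefficients\<close>

abbreviation fourier_mode :: "real \<Rightarrow> int \<Rightarrow> complex" where
  "fourier_mode z k \<equiv> cis (2 * pi * of_int k * z)"

definition residue_weight :: "nat \<Rightarrow> nat \<Rightarrow> int \<Rightarrow> real" where
  "residue_weight m N k = (\<Sum>\<^sub>\<infinity>t\<in>UNIV. fourier_weight m (k + t * int N))"

text \<open>Divided by \<open>residue_weight\<close> it is the weighted mean of exp(2 pi i k z) over
  the class of k, hence the optimal value of the discrete transform there.\<close>

definition residue_moment :: "nat \<Rightarrow> nat \<Rightarrow> real \<Rightarrow> int \<Rightarrow> complex" where
  "residue_moment m N z k =
     (\<Sum>\<^sub>\<infinity>t\<in>UNIV. of_real (fourier_weight m (k + t * int N)) * fourier_mode z (k + t * int N))"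

context
  fixes m N :: nat and z :: real
  assumes m: "m \<ge> 1" and N: "N \<ge> 1"
begin

lemma fourier_term_summable:
  assumes "\<And>k. cmod (u k) \<le> B"
  shows "(\<lambda>k. of_real (fourier_weight m k) * u k) summable_on A"
proof (rule Infinite_Sum.abs_summable_summable, rule Infinite_Sum.abs_summable_on_comparison_test')
  show "(\<lambda>k. fourier_weight m k * B) summable_on A"
    by (intro summable_on_cmult_left fourier_weight_summable m)
  show "norm (of_real (fourier_weight m k) * u k) \<le> fourier_weight m k * B" for k
    using assms[of k] fourier_weight_nonneg[of m k] by (simp add: norm_mult mult_left_mono)
qed

lemma residue_weight_has_sum: "((\<lambda>t. fourier_weight m (k + t * int N)) has_sum
    residue_weight m N k) UNIV"
  unfolding residue_weight_def using N
  by (intro has_sum_infsum residue_class_summable fourier_weight_summable m) auto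

lemma residue_moment_has_sum:
  "((\<lambda>t. of_real (fourier_weight m (k + t * int N)) * fourier_mode z (k + t * int N)) has_sum
      residue_moment m N z k) UNIV"
  unfolding residue_moment_def using N
  by (intro has_sum_infsum residue_class_summable[of "\<lambda>k. of_real (fourier_weight m k) *
      fourier_mode z k"] fourier_term_summable[of _ 1]) auto

lemma residue_periodic: "residue_weight m N (k + t * int N) = residue_weight m N k"
    "residue_moment m N z (k + t * int N) = residue_moment m N z k"
proof -
  have eq: "k + t * int N + s * int N = k + (s + t) * int N" for s
    by (simp add: algebra_simps)
  show "residue_weight m N (k + t * int N) = residue_weight m N k"
    unfolding residue_weight_def eq by (rule infsum_int_shift)
  show "residue_moment m N z (k + t * int N) = residue_moment m N z k"
    unfolding residue_moment_def eq by (rule infsum_int_shift)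
qed

lemma residue_minus: "residue_weight m N (- k) = residue_weight m N k" "residue_moment m N z (- k) =
    cnj (residue_moment m N z k)"
proof -
  have eq: "- k + - t * int N = - (k + t * int N)" for t
    by simp
  have "residue_weight m N (- k) = (\<Sum>\<^sub>\<infinity>t\<in>UNIV. fourier_weight m (- k + - t * int N))"
    unfolding residue_weight_def by (rule infsum_int_reflect[symmetric])
  then show "residue_weight m N (- k) = residue_weight m N k"
    unfolding eq fourier_weight_minus residue_weight_def .
  have "residue_moment m N z (- k) = (\<Sum>\<^sub>\<infinity>t\<in>UNIV. of_real (fourier_weight m (- k + - t * int N)) *
      fourier_mode z (- k + - t * int N))"
    unfolding residue_moment_def by (rule infsum_int_reflect[symmetric])
  also have "\<dots> = (\<Sum>\<^sub>\<infinity>t\<in>UNIV. cnj (of_real (fourier_weight m (k + t * int N)) * fourier_mode z (k +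
      t * int N)))"
  proof -
    have "fourier_mode z (- j) = cnj (fourier_mode z j)" for j by (simp add: cis_cnj)
    then show ?thesis
      unfolding eq fourier_weight_minus by (simp only: complex_cnj_mult complex_cnj_complex_of_real)
  qed
  also have "\<dots> = cnj (residue_moment m N z k)"
    unfolding residue_moment_def by (rule infsum_cnj)
  finally show "residue_moment m N z (- k) = cnj (residue_moment m N z k)" .
qed

lemma residue_weight_pos:
  assumes "\<not> int N dvd k"
  shows "residue_weight m N k > 0"
proof -
  have "fourier_weight m k = (\<Sum>t\<in>{0}. fourier_weight m (k + t * int N))" by simp
  also have "\<dots> \<le> residue_weight m N k"
    by (rule finite_sum_le_has_sum[OF residue_weight_has_sum]) (auto intro: fourier_weight_nonneg)
  finally show ?thesis
    using assms fourier_weight_pos[of k m] by (cases "k = 0") auto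
qed

lemma residue_moment_le_weight: "cmod (residue_moment m N z k) \<le> residue_weight m N k"
proof (rule norm_has_sum_bound[OF _ residue_moment_has_sum])
  have "norm (of_real (fourier_weight m j) * fourier_mode z j) = fourier_weight m j" for j
    using fourier_weight_nonneg[of m j] by (simp add: norm_mult)
  then show "((\<lambda>t. norm (of_real (fourier_weight m (k + t * int N)) * fourier_mode z (k + t *
      int N))) has_sum residue_weight m N k) UNIV"
    using residue_weight_has_sum by (simp only:)
qed

lemma not_dvd_residue: "j \<in> {1..<int N} \<Longrightarrow> \<not> int N dvd j"
  by (auto dest: zdvd_imp_le)

lemma split_zero_class:
  fixes f :: "int \<Rightarrow> 'a :: ab_group_add"
  shows "(\<Sum>j\<in>{0..<int N}. f j) = f 0 + (\<Sum>j\<in>{1..<int N}. f j)"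
proof -
  have "{0..<int N} = insert 0 {1..<int N}" using N by auto
  then show ?thesis by simp
qed

definition optimal_energy :: real where
  "optimal_energy =
     (\<Sum>\<^sub>\<infinity>t\<in>UNIV. fourier_weight m (t * int N) * (cmod (fourier_mode z (t * int N) - 1))\<^sup>2) +
     (\<Sum>j\<in>{1..<int N}. residue_weight m N j - (cmod (residue_moment m N z j))\<^sup>2 / residue_weight m N j)"

definition discrete_transform :: "(nat \<Rightarrow> real) \<Rightarrow> int \<Rightarrow> complex" where
  "discrete_transform C k = (\<Sum>\<beta>=1..N. of_real (C \<beta>) * cis (2 * pi * of_int k * (real \<beta> / real N)))"

text \<open>Nodes at multiples of 1/N make the transform constant on each residue class, so the
  square can be completed class by class. On the class of 0 the constraint fixes the transform at 1,
  and the whole deviation enters \<open>optimal_energy\<close>.\<close>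

lemma error_energy_split:
  assumes C: "(\<Sum>\<beta>=1..N. C \<beta>) = 1" and h: "h = 1 / real N"
    and E: "((\<lambda>k. fourier_weight m k * (cmod (error_coeff h N z C k))\<^sup>2) has_sum E) UNIV"
  shows "E = optimal_energy +
    (\<Sum>j\<in>{1..<int N}. residue_weight m N j * (cmod (discrete_transform C j - residue_moment m N z j /
        of_real (residue_weight m N j)))\<^sup>2)"
proof -
  let ?d = "discrete_transform C"
  have d: "?d (j + t * int N) = ?d j" for j t
  proof -
    have "cis (2 * pi * of_int (j + t * int N) * (real \<beta> / real N)) =
        cis (2 * pi * of_int j * (real \<beta> / real N))" for \<beta>
    proof -
      have "2 * pi * of_int (j + t * int N) * (real \<beta> / real N) =
          2 * pi * of_int j * (real \<beta> / real N) + 2 * pi * of_int (t * int \<beta>)"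
        using N by (simp add: field_simps)
      then have "cis (2 * pi * of_int (j + t * int N) * (real \<beta> / real N)) =
          cis (2 * pi * of_int j * (real \<beta> / real N)) * cis (2 * pi * of_int (t * int \<beta>))"
        by (simp only: cis_mult)
      also have "cis (2 * pi * of_int (t * int \<beta>)) = 1" by (rule cis_multiple_2pi) simp
      finally show ?thesis by simp
    qed
    then show ?thesis by (simp add: discrete_transform_def)
  qed
  have d0: "?d 0 = 1"
    using C by (simp add: discrete_transform_def flip: of_real_sum)
  have coeff: "error_coeff h N z C k = fourier_mode z k - ?d k" for k
    by (simp add: error_coeff_def discrete_transform_def h)
  have "E = (\<Sum>j\<in>{0..<int N}. \<Sum>\<^sub>\<infinity>t\<in>UNIV. fourier_weight m (j + t * int N) * (cmod (error_coeff h N z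
      C (j + t * int N)))\<^sup>2)"
    using infsum_residue_classes[OF has_sum_imp_summable[OF E], of N] infsumI[OF E] N by simp
  also have "\<dots> = (\<Sum>j\<in>{0..<int N}. \<Sum>\<^sub>\<infinity>t\<in>UNIV. fourier_weight m (j + t * int N) * (cmod (fourier_mode
      z (j + t * int N) - ?d j))\<^sup>2)"
    unfolding coeff d ..
  also have "\<dots> = (\<Sum>\<^sub>\<infinity>t\<in>UNIV. fourier_weight m (t * int N) * (cmod (fourier_mode z (t * int N) - 1))\<^sup>2) +
      (\<Sum>j\<in>{1..<int N}. \<Sum>\<^sub>\<infinity>t\<in>UNIV. fourier_weight m (j + t * int N) * (cmod (fourier_mode z (j + t *
          int N) - ?d j))\<^sup>2)"
    unfolding split_zero_class d0 by simp
  also have "(\<Sum>j\<in>{1..<int N}. \<Sum>\<^sub>\<infinity>t\<in>UNIV. fourier_weight m (j + t * int N) * (cmod (fourier_mode z (j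
      + t * int N) - ?d j))\<^sup>2) =
      (\<Sum>j\<in>{1..<int N}. residue_weight m N j - (cmod (residue_moment m N z j))\<^sup>2 / residue_weight m N
          j + residue_weight m N j * (cmod (?d j - residue_moment m N z j / of_real (residue_weight
              m N j)))\<^sup>2)"
  proof (rule sum.cong[OF refl])
    fix j assume "j \<in> {1..<int N}"
    then have "residue_weight m N j > 0" by (intro residue_weight_pos not_dvd_residue)
    then show "(\<Sum>\<^sub>\<infinity>t\<in>UNIV. fourier_weight m (j + t * int N) * (cmod (fourier_mode z (j + t *
        int N) - ?d j))\<^sup>2) =
        residue_weight m N j - (cmod (residue_moment m N z j))\<^sup>2 / residue_weight m N j +
            residue_weight m N j * (cmod (?d j - residue_moment m N z j / of_real (residue_weight m
                N j)))\<^sup>2"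
      by (intro infsumI weighted_square_deviation residue_weight_has_sum residue_moment_has_sum) auto
  qed
  finally show ?thesis
    unfolding optimal_energy_def by (simp only: sum.distrib add.assoc)
qed

text \<open>The prescribed transform is 1 on multiples of N, which encodes the constraint at
  frequency 0. Its Hermitian symmetry comes from \<open>residue_minus\<close>, so the interpolating
  coefficients can be taken real.\<close>

lemma optimal_coeffs_exist:
  obtains C :: "nat \<Rightarrow> real" where "(\<Sum>\<beta>=1..N. C \<beta>) = 1"
    "\<And>j. j \<in> {1..<int N} \<Longrightarrow> discrete_transform C j =
        residue_moment m N z j / of_real (residue_weight m N j)"
proof -
  define c where "c k = (if int N dvd k then 1 else residue_moment m N z k / of_real (residue_weight
      m N k))" for k
  have "c (k + t * int N) = c k" for k t
    by (simp add: c_def residue_periodic dvd_add_left_iff)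
  moreover have "c (- k) = cnj (c k)" for k
    by (simp add: c_def residue_minus)
  ultimately obtain C where C: "\<And>l. discrete_transform C l = c l"
    using discrete_fourier_interpolation[of N c] N unfolding discrete_transform_def
        by (metis less_eq_Suc_le One_nat_def)
  show thesis
  proof (rule that[of C])
    have "complex_of_real (\<Sum>\<beta>=1..N. C \<beta>) = 1"
      using C[of 0] by (simp add: discrete_transform_def c_def)
    then show "(\<Sum>\<beta>=1..N. C \<beta>) = 1" by (simp only: of_real_eq_1_iff)
    show "discrete_transform C j = residue_moment m N z j / of_real (residue_weight m N j)"
        if "j \<in> {1..<int N}" for j
      using not_dvd_residue[OF that] by (simp add: C c_def)
  qed
qed

text \<open>A squeeze: the competitor D attains \<open>optimal_energy\<close>, and the nonnegative
  remainder in \<open>error_energy_split\<close> bounds every admissible choice from below.\<close>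

lemma dual_norm_optimal:
  assumes h: "h = 1 / real N" and z: "z \<in> {0..1}" and opt: "optimal_coeffs m h N z C"
  shows "(dual_norm m (error_functional h N z C))\<^sup>2 = optimal_energy"
proof -
  have nodes: "h * real \<beta> \<in> {0..1}" if "\<beta> \<in> {1..N}" for \<beta>
    using that by (simp add: h)
  have C: "(\<Sum>\<beta>=1..N. C \<beta>) = 1"
    using opt by (simp add: optimal_coeffs_def)
  obtain D where D: "(\<Sum>\<beta>=1..N. D \<beta>) = 1"
    "\<And>j. j \<in> {1..<int N} \<Longrightarrow> discrete_transform D j =
        residue_moment m N z j / of_real (residue_weight m N j)"
    using optimal_coeffs_exist by blast
  have "(dual_norm m (error_functional h N z C))\<^sup>2 \<le> (dual_norm m (error_functional h N z D))\<^sup>2"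
    using opt D(1) by (intro power_mono dual_norm_error_functional_square m z nodes C) (auto simp:
        optimal_coeffs_def)
  also have "\<dots> = optimal_energy"
    using error_energy_split[OF D(1) h dual_norm_error_functional_square(1)[OF m z nodes D(1)]] D(2)
        by simp
  finally have "(dual_norm m (error_functional h N z C))\<^sup>2 \<le> optimal_energy" .
  moreover have "optimal_energy \<le> (dual_norm m (error_functional h N z C))\<^sup>2"
  proof -
    have "0 \<le> (\<Sum>j\<in>{1..<int N}. residue_weight m N j * (cmod (discrete_transform C j -
        residue_moment m N z j / of_real (residue_weight m N j)))\<^sup>2)"
      by (intro sum_nonneg mult_nonneg_nonneg less_imp_le[OF residue_weight_pos] not_dvd_residue) auto
    then show ?thesis
      using error_energy_split[OF C h dual_norm_error_functional_square(1)[OF m z nodes C]] by simp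
  qed
  ultimately show ?thesis by simp
qed

text \<open>Off the multiples of N, summing w(k) e(k) cnj S / W over a class gives |S|^2/W. On the
  multiples, |e - 1|^2 = 2 - e - cnj e, and e may be exchanged for cnj e only under the sum.\<close>

lemma optimal_energy_eq_infsum:
  "of_real optimal_energy = (\<Sum>\<^sub>\<infinity>k\<in>UNIV. of_real (fourier_weight m k) *
     (if int N dvd k then 2 - 2 * cnj (fourier_mode z k) else 1 - fourier_mode z k *
         cnj (residue_moment m N z k) / of_real (residue_weight m N k)))"
proof -
  define F where "F k = (if int N dvd k then 2 - 2 * cnj (fourier_mode z k) else 1 -
      fourier_mode z k * cnj (residue_moment m N z k) / of_real (residue_weight m N k))" for k
  have "cmod (F k) \<le> 4" for k
  proof (cases "int N dvd k")
    case True
    have "cmod (2 - 2 * cnj (fourier_mode z k)) \<le> cmod 2 + cmod (2 * cnj (fourier_mode z k))"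
        by (rule norm_triangle_ineq4)
    then show ?thesis using True by (simp add: F_def norm_mult)
  next
    case False
    have "cmod (1 - fourier_mode z k * cnj (residue_moment m N z k) / of_real (residue_weight m N
        k)) \<le> cmod 1 + cmod (fourier_mode z k * cnj (residue_moment m N z k) / of_real
            (residue_weight m N k))"
      by (rule norm_triangle_ineq4)
    also have "cmod (fourier_mode z k * cnj (residue_moment m N z k) / of_real (residue_weight m N
        k)) \<le> 1"
      using residue_moment_le_weight[of k] residue_weight_pos[OF False]
      by (simp add: norm_mult norm_divide)
    finally show ?thesis using False by (simp add: F_def)
  qed
  then have "(\<lambda>k. of_real (fourier_weight m k) * F k) summable_on UNIV"
    by (rule fourier_term_summable)
  then have "(\<Sum>\<^sub>\<infinity>k\<in>UNIV. of_real (fourier_weight m k) * F k) =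
      (\<Sum>j\<in>{0..<int N}. \<Sum>\<^sub>\<infinity>t\<in>UNIV. of_real (fourier_weight m (j + t * int N)) * F (j + t * int N))"
    using infsum_residue_classes[of "\<lambda>k. of_real (fourier_weight m k) * F k" N] N by simp
  also have "\<dots> = (\<Sum>\<^sub>\<infinity>t\<in>UNIV. of_real (fourier_weight m (t * int N)) * F (t * int N)) +
      (\<Sum>j\<in>{1..<int N}. \<Sum>\<^sub>\<infinity>t\<in>UNIV. of_real (fourier_weight m (j + t * int N)) * F (j + t * int N))"
    unfolding split_zero_class by simp
  also have "(\<Sum>\<^sub>\<infinity>t\<in>UNIV. of_real (fourier_weight m (t * int N)) * F (t * int N)) =
      of_real (\<Sum>\<^sub>\<infinity>t\<in>UNIV. fourier_weight m (t * int N) * (cmod (fourier_mode z (t * int N) - 1))\<^sup>2)"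
  proof -
    have hW: "((\<lambda>t. of_real (fourier_weight m (t * int N)) :: complex) has_sum
        of_real (residue_weight m N 0)) UNIV"
      using has_sum_of_real[OF residue_weight_has_sum[of 0]] by simp
    have hS: "((\<lambda>t. of_real (fourier_weight m (t * int N)) * fourier_mode z (t * int N)) has_sum
        residue_moment m N z 0) UNIV"
      using residue_moment_has_sum[of 0] by simp
    have hS': "((\<lambda>t. cnj (of_real (fourier_weight m (t * int N)) * fourier_mode z (t *
        int N))) has_sum cnj (residue_moment m N z 0)) UNIV"
      using hS by (subst has_sum_cnj_iff)
    \<comment> \<open>Reflection k -> -k maps the class of 0 to itself, so its moment is real; this
      is what permits the exchange.\<close>
    have S0: "cnj (residue_moment m N z 0) = residue_moment m N z 0" using residue_minus(2)[of 0] by simp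
    have "((\<lambda>t. 2 * of_real (fourier_weight m (t * int N)) - 2 * cnj (of_real (fourier_weight m (t *
        int N)) * fourier_mode z (t * int N))) has_sum
        2 * of_real (residue_weight m N 0) - 2 * cnj (residue_moment m N z 0)) UNIV"
      by (intro has_sum_minus has_sum_cmult_right hW hS')
    then have A: "(\<Sum>\<^sub>\<infinity>t\<in>UNIV. of_real (fourier_weight m (t * int N)) * F (t * int N)) =
        2 * of_real (residue_weight m N 0) - 2 * cnj (residue_moment m N z 0)"
      by (intro infsumI) (simp add: F_def algebra_simps)
    have hs: "((\<lambda>t. 2 * of_real (fourier_weight m (t * int N)) - of_real (fourier_weight m (t *
        int N)) * fourier_mode z (t * int N)
        - cnj (of_real (fourier_weight m (t * int N)) * fourier_mode z (t * int N))) has_sum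
            2 * of_real (residue_weight m N 0) - residue_moment m N z 0 - cnj (residue_moment m N z
                0)) UNIV"
      by (intro has_sum_minus has_sum_cmult_right hW hS hS')
    have key: "2 * of_real (fourier_weight m k) - of_real (fourier_weight m k) * fourier_mode z k -
        cnj (of_real (fourier_weight m k) * fourier_mode z k) =
        complex_of_real (fourier_weight m k * (cmod (fourier_mode z k - 1))\<^sup>2)" for k
    proof -
      have "fourier_mode z k * cnj (fourier_mode z k) = 1" by (simp add: cis_cnj cis_mult)
      then have "(fourier_mode z k - 1) * cnj (fourier_mode z k - 1) =
          2 - fourier_mode z k - cnj (fourier_mode z k)"
        by (simp add: algebra_simps)
      then show ?thesis
        by (simp only: of_real_mult complex_norm_square complex_cnj_mult
            complex_cnj_complex_of_real) (simp add: algebra_simps)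
    qed
    have "2 * of_real (residue_weight m N 0) - residue_moment m N z 0 - cnj (residue_moment m N z 0) =
        of_real (\<Sum>\<^sub>\<infinity>t\<in>UNIV. fourier_weight m (t * int N) * (cmod (fourier_mode z (t * int N) - 1))\<^sup>2)"
    proof -
      have "2 * of_real (residue_weight m N 0) - residue_moment m N z 0 - cnj (residue_moment m N z
          0) = of_real (2 * residue_weight m N 0 - 2 * Re (residue_moment m N z 0))"
        by (simp add: complex_eq_iff)
      then show ?thesis
        using hs[unfolded key] infsumI by (simp only: has_sum_of_real_iff) fastforce
    qed
    then show ?thesis using A S0 by simp
  qed
  also have "(\<Sum>j\<in>{1..<int N}. \<Sum>\<^sub>\<infinity>t\<in>UNIV. of_real (fourier_weight m (j + t * int N)) * F (j + t *
      int N)) =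
      (\<Sum>j\<in>{1..<int N}. of_real (residue_weight m N j - (cmod (residue_moment m N z j))\<^sup>2 /
          residue_weight m N j))"
  proof (rule sum.cong[OF refl])
    fix j assume "j \<in> {1..<int N}"
    then have nd: "\<not> int N dvd j" by (rule not_dvd_residue)
    have "((\<lambda>t. of_real (fourier_weight m (j + t * int N)) - cnj (residue_moment m N z j) / of_real
        (residue_weight m N j) * (of_real (fourier_weight m (j + t * int N)) * fourier_mode z (j +
            t * int N)))
        has_sum of_real (residue_weight m N j) - cnj (residue_moment m N z j) / of_real
            (residue_weight m N j) * residue_moment m N z j) UNIV"
      by (intro has_sum_minus has_sum_cmult_right residue_moment_has_sum
          has_sum_of_real residue_weight_has_sum)
    moreover have "of_real (fourier_weight m (j + t * int N)) - cnj (residue_moment m N z j) /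
        of_real (residue_weight m N j) * (of_real (fourier_weight m (j + t * int N)) *
            fourier_mode z (j + t * int N)) =
        of_real (fourier_weight m (j + t * int N)) * F (j + t * int N)" for t
    proof -
      have "\<not> int N dvd j + t * int N" using nd by (simp add: dvd_add_left_iff)
      then show ?thesis by (simp add: F_def residue_periodic right_diff_distrib mult_ac)
    qed
    ultimately have "((\<lambda>t. of_real (fourier_weight m (j + t * int N)) * F (j + t * int N))
        has_sum of_real (residue_weight m N j) - cnj (residue_moment m N z j) / of_real
            (residue_weight m N j) * residue_moment m N z j) UNIV" by simp
    then show "(\<Sum>\<^sub>\<infinity>t\<in>UNIV. of_real (fourier_weight m (j + t * int N)) * F (j + t * int N)) =
        of_real (residue_weight m N j - (cmod (residue_moment m N z j))\<^sup>2 / residue_weight m N j)"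
      by (subst infsumI) (simp_all add: complex_norm_square mult.commute flip: of_real_power)
  qed
  finally show ?thesis
    by (simp add: optimal_energy_def F_def)
qed

end

section \<open>The norm formula\<close>

lemma fourier_weight_complex:
  "1 / (2 * of_real pi * \<i> * of_int k) ^ (2 * m) = (-1) ^ m * complex_of_real (fourier_weight m k)"
proof -
  have "(2 * of_real pi * \<i> * of_int k :: complex) ^ 2 = - of_real ((2 * pi * of_int k) ^ 2)"
    by (simp add: power_mult_distrib)
  then have "(2 * of_real pi * \<i> * of_int k :: complex) ^ (2 * m) =
      (- of_real ((2 * pi * of_int k) ^ 2)) ^ m"
    by (simp only: power_mult)
  also have "\<dots> = (-1) ^ m * of_real ((2 * pi * of_int k) ^ (2 * m))"
    by (subst power_minus) (simp only: of_real_power power_mult)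
  finally have "(2 * of_real pi * \<i> * of_int k :: complex) ^ (2 * m) =
      (-1) ^ m * of_real ((2 * pi * of_int k) ^ (2 * m))" .
  moreover have "1 / ((-1) ^ m * x) = (-1) ^ m * (1 / x)" for x :: complex
    by (cases "even m") auto
  ultimately show ?thesis
    by (simp only: fourier_weight_def of_real_divide of_real_1)
qed

text \<open>The even exponent absorbs the sign of the difference; the index t appears reflected and
  is reflected back when summing.\<close>

lemma inverse_grid_power:
  "1 / (of_int t * real N - of_int k) ^ (2 * m) = (2 * pi) ^ (2 * m) * fourier_weight m (k + - t *
      int N)"
proof -
  have "(of_int t * real N - of_int k) ^ (2 * m) = (of_int k - of_int t * real N) ^ (2 * m)"
    by (rule power2_commute[of "of_int t * real N", THEN arg_cong[where f =
        "\<lambda>x. x ^ m"], folded power_mult])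
  then show ?thesis
    by (simp add: fourier_weight_def power_mult_distrib[of "2 * pi"])
qed

lemma L_coeff_eq:
  assumes "N \<ge> 1" "h = 1 / real N"
  shows "L_coeff m h k = inverse ((2 * pi) ^ (2 * m) * residue_weight m N k)"
proof -
  have "h ^ (2 * m) / (of_int \<gamma> - of_int k * h) ^ (2 * m) =
      (2 * pi) ^ (2 * m) * fourier_weight m (k + - \<gamma> * int N)" for \<gamma>
  proof -
    have "h / (of_int \<gamma> - of_int k * h) = 1 / (of_int \<gamma> * real N - of_int k)"
    proof -
      have hN: "real N * h = 1" "h \<noteq> 0" using assms by auto
      then have "of_int \<gamma> - of_int k * h = (of_int \<gamma> * real N - of_int k) * h"
        by (simp add: left_diff_distrib mult.assoc)
      then show ?thesis using hN by simp
    qed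
    then have "h ^ (2 * m) / (of_int \<gamma> - of_int k * h) ^ (2 * m) =
        1 / (of_int \<gamma> * real N - of_int k) ^ (2 * m)"
      by (metis power_divide power_one)
    then show ?thesis by (simp only: inverse_grid_power)
  qed
  then have "L_coeff m h k = inverse (\<Sum>\<^sub>\<infinity>\<gamma>\<in>UNIV. (2 * pi) ^ (2 * m) * fourier_weight m (k + - \<gamma> *
      int N))"
    by (simp only: L_coeff_def)
  also have "(\<Sum>\<^sub>\<infinity>\<gamma>\<in>UNIV. (2 * pi) ^ (2 * m) * fourier_weight m (k + - \<gamma> * int N)) =
      (2 * pi) ^ (2 * m) * (\<Sum>\<^sub>\<infinity>\<gamma>\<in>UNIV. fourier_weight m (k + - \<gamma> * int N))"
    by (rule infsum_cmult_right')
  also have "(\<Sum>\<^sub>\<infinity>\<gamma>\<in>UNIV. fourier_weight m (k + - \<gamma> * int N)) = residue_weight m N k"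
    unfolding residue_weight_def by (rule infsum_int_reflect)
  finally show ?thesis .
qed

text \<open>With e(k) = exp(2 pi i k z), the numerator factors as exp(2 pi i z t N) = e(k) cnj (e(k
  - t N)); the factor e(k) leaves the sum and a conjugated moment remains.\<close>

lemma aliasing_sum_eq:
  assumes m: "m \<ge> 1" and N: "N \<ge> 1" and h: "h = 1 / real N"
  shows "(\<Sum>\<^sub>\<infinity>t\<in>(UNIV::int set).
      exp (2 * of_real pi * \<i> * of_real z * of_int t * of_real (inverse h))
        / (of_int t * of_real (inverse h) - of_int k) ^ (2 * m)) =
    of_real ((2 * pi) ^ (2 * m)) * (fourier_mode z k * cnj (residue_moment m N z k))"
proof -
  have ih: "inverse h = real N" by (simp add: h)
  have summand: "exp (2 * of_real pi * \<i> * of_real z * of_int t * of_real (inverse h))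
        / (of_int t * of_real (inverse h) - of_int k) ^ (2 * m) =
      (of_real ((2 * pi) ^ (2 * m)) * fourier_mode z k) *
      cnj (of_real (fourier_weight m (k + - t * int N)) * fourier_mode z (k + - t * int N))" for t
  proof -
    have "1 / (of_int t * of_real (inverse h) - of_int k :: complex) ^ (2 * m) =
        of_real (1 / (of_int t * real N - of_int k) ^ (2 * m))"
      by (simp add: ih)
    also have "\<dots> = of_real ((2 * pi) ^ (2 * m) * fourier_weight m (k + - t * int N))"
      by (simp only: inverse_grid_power)
    finally have a: "1 / (of_int t * of_real (inverse h) - of_int k :: complex) ^ (2 * m) =
      of_real ((2 * pi) ^ (2 * m)) * of_real (fourier_weight m (k + - t * int N))"
      by (simp only: of_real_mult)
    have "exp (2 * of_real pi * \<i> * of_real z * of_int t * of_real (inverse h)) =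
        cis (2 * pi * (of_int t * real N) * z)"
      by (simp add: ih cis_conv_exp mult_ac)
    also have "\<dots> = fourier_mode z k * cnj (fourier_mode z (k + - t * int N))"
      by (simp add: cis_cnj cis_mult algebra_simps)
    finally have b: "exp (2 * of_real pi * \<i> * of_real z * of_int t * of_real (inverse h)) =
        fourier_mode z k * cnj (fourier_mode z (k + - t * int N))" .
    have d: "x / y = x * (1 / y)" for x y :: complex by simp
    show ?thesis
      by (subst d, subst a, subst b) (simp only: complex_cnj_mult complex_cnj_complex_of_real mult_ac)
  qed
  have "(\<Sum>\<^sub>\<infinity>t\<in>UNIV. cnj (of_real (fourier_weight m (k + - t * int N)) * fourier_mode z (k + - t *
      int N))) =
      (\<Sum>\<^sub>\<infinity>t\<in>UNIV. cnj (of_real (fourier_weight m (k + t * int N)) * fourier_mode z (k + t * int N)))"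
    by (rule infsum_int_reflect)
  also have "\<dots> = cnj (residue_moment m N z k)"
    unfolding residue_moment_def by (rule infsum_cnj)
  finally show ?thesis
    unfolding summand infsum_cmult_right' by (simp only: mult.assoc)
qed

theorem theorem7p1:
  fixes m N :: nat and h z :: real and C :: "nat \<Rightarrow> real"
  assumes "m \<ge> 1" and "N \<ge> 1" and "h = 1 / real N" and "z \<in> {0..1}"
    and "optimal_coeffs m h N z C"
  shows "complex_of_real ((dual_norm m (error_functional h N z C))\<^sup>2) =
    (-1) ^ m *
     ((\<Sum>\<^sub>\<infinity>k\<in>{k::int. k \<noteq> 0}. 1 / (2 * of_real pi * \<i> * of_int k) ^ (2 * m))
      - (\<Sum>\<^sub>\<infinity>k\<in>{k::int. k \<noteq> 0 \<and> real_of_int k * h \<in> \<int>}.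
           (2 * exp (- 2 * of_real pi * \<i> * of_int k * of_real z) - 1)
             / (2 * of_real pi * \<i> * of_int k) ^ (2 * m))
      - (\<Sum>\<^sub>\<infinity>k\<in>{k::int. real_of_int k * h \<notin> \<int>}.
           of_real (L_coeff m h k) / (2 * of_real pi * \<i> * of_int k) ^ (2 * m)
             * (\<Sum>\<^sub>\<infinity>t\<in>(UNIV::int set).
                  exp (2 * of_real pi * \<i> * of_real z * of_int t * of_real (inverse h))
                    / (of_int t * of_real (inverse h) - of_int k) ^ (2 * m))))"
proof -
  note m = assms(1) and N = assms(2) and h = assms(3)
  let ?w = "\<lambda>k. complex_of_real (fourier_weight m k)" and ?W = "residue_weight m N"
    and ?S = "residue_moment m N z" and ?e = "fourier_mode z"
  \<comment> \<open>\<open>P\<close> and \<open>Q\<close> extend the summands of the second and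
    third sums by zero, so that all three sums run over all integers; k = 0 is harmless because its
    weight vanishes.\<close>
  define P where "P k = (if int N dvd k then 2 * cnj (?e k) - 1 else 0)" for k
  define Q where "Q k = (if int N dvd k then 0 else ?e k * cnj (?S k) / of_real (?W k))" for k
  have w0: "fourier_weight m 0 = 0" using m by (simp add: fourier_weight_def)
  have grid: "real_of_int k * h \<in> \<int> \<longleftrightarrow> int N dvd k" for k
  proof
    assume "real_of_int k * h \<in> \<int>"
    then obtain n where "real_of_int k * h = of_int n" by (elim Ints_cases)
    then have "real_of_int k = of_int (n * int N)" using N by (simp add: h field_simps)
    then have "k = n * int N" by (simp only: of_int_eq_iff)
    then show "int N dvd k" by simp
  qed (use N in \<open>auto simp: h\<close>)
  have T1: "(\<Sum>\<^sub>\<infinity>k\<in>{k::int. k \<noteq> 0}. 1 / (2 * of_real pi * \<i> * of_int k) ^ (2 * m)) =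
      (-1) ^ m * (\<Sum>\<^sub>\<infinity>k\<in>UNIV. ?w k * 1)"
    unfolding fourier_weight_complex infsum_cmult_right'[symmetric]
    by (rule infsum_cong_neutral) (auto simp: w0)
  have T2: "(\<Sum>\<^sub>\<infinity>k\<in>{k::int. k \<noteq> 0 \<and> real_of_int k * h \<in> \<int>}.
        (2 * exp (- 2 * of_real pi * \<i> * of_int k * of_real z) - 1)
          / (2 * of_real pi * \<i> * of_int k) ^ (2 * m)) =
      (-1) ^ m * (\<Sum>\<^sub>\<infinity>k\<in>UNIV. ?w k * P k)"
    unfolding infsum_cmult_right'[symmetric]
  proof (rule infsum_cong_neutral)
    fix k assume k: "k \<in> {k. k \<noteq> 0 \<and> real_of_int k * h \<in> \<int>} \<inter> UNIV"
    have d: "x / y = x * (1 / y)" for x y :: complex by simp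
    have "cnj (?e k) = cis (- (2 * pi * of_int k * z))" by (simp only: cis_cnj)
    moreover have "\<i> * of_real (- (2 * pi * of_int k * z)) = - 2 * of_real pi * \<i> * of_int k * of_real z"
      by (simp add: mult_ac)
    ultimately have "exp (- 2 * of_real pi * \<i> * of_int k * of_real z) = cnj (?e k)"
      by (simp only: cis_conv_exp)
    then show "(2 * exp (- 2 * of_real pi * \<i> * of_int k * of_real z) - 1)
          / (2 * of_real pi * \<i> * of_int k) ^ (2 * m) = (-1) ^ m * (?w k * P k)"
      using k by (subst d) (simp add: P_def grid fourier_weight_complex del: mult_minus_left)
  qed (auto simp: w0 P_def grid)
  have T3: "(\<Sum>\<^sub>\<infinity>k\<in>{k::int. real_of_int k * h \<notin> \<int>}.
        of_real (L_coeff m h k) / (2 * of_real pi * \<i> * of_int k) ^ (2 * m)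
          * (\<Sum>\<^sub>\<infinity>t\<in>(UNIV::int set).
               exp (2 * of_real pi * \<i> * of_real z * of_int t * of_real (inverse h))
                 / (of_int t * of_real (inverse h) - of_int k) ^ (2 * m))) =
      (-1) ^ m * (\<Sum>\<^sub>\<infinity>k\<in>UNIV. ?w k * Q k)"
    unfolding infsum_cmult_right'[symmetric] aliasing_sum_eq[OF m N h] L_coeff_eq[OF N h]
  proof (rule infsum_cong_neutral)
    fix k assume k: "k \<in> {k. real_of_int k * h \<notin> \<int>} \<inter> UNIV"
    \<comment> \<open>Used with p = (2 pi)^(2m), the factor in which \<open>L_coeff\<close> and the
      aliasing sum cancel.\<close>
    have c: "inverse (p * W) * s * (p * (x * y)) = s * (x * y / W)" if "p \<noteq> 0" for p W s x y :: complex
      using that by (simp add: field_simps)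
    have "of_real (inverse ((2 * pi) ^ (2 * m) * ?W k)) / (2 * of_real pi * \<i> * of_int k) ^ (2 * m)
        * (of_real ((2 * pi) ^ (2 * m)) * (?e k * cnj (?S k))) =
        inverse (of_real ((2 * pi) ^ (2 * m)) * of_real (?W k)) * (1 / (2 * of_real pi * \<i> *
            of_int k) ^ (2 * m))
        * (of_real ((2 * pi) ^ (2 * m)) * (?e k * cnj (?S k)))"
      by (simp only: of_real_inverse of_real_mult times_divide_eq_right mult_1_right)
    also have "\<dots> = 1 / (2 * of_real pi * \<i> * of_int k) ^ (2 * m) * (?e k * cnj (?S k) / of_real (?W k))"
      by (rule c) simp
    also have "\<dots> = (-1) ^ m * (?w k * Q k)"
      unfolding fourier_weight_complex using k by (simp add: Q_def grid)
    finally show "of_real (inverse ((2 * pi) ^ (2 * m) * ?W k)) / (2 * of_real pi * \<i> *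
        of_int k) ^ (2 * m)
        * (of_real ((2 * pi) ^ (2 * m)) * (?e k * cnj (?S k))) = (-1) ^ m * (?w k * Q k)" .
  qed (auto simp: Q_def grid)
  have P3: "cmod (P k) \<le> 3" for k
    using norm_triangle_ineq4[of "2 * cnj (?e k)" 1] by (simp add: P_def norm_mult)
  have Q1: "cmod (Q k) \<le> 1" for k
  proof (cases "int N dvd k")
    case False
    then show ?thesis
      using residue_moment_le_weight[OF m N, of z k] residue_weight_pos[OF m N False]
      by (simp add: Q_def norm_mult norm_divide)
  qed (simp add: Q_def)
  have "((\<lambda>k. ?w k * 1 - ?w k * P k - ?w k * Q k) has_sum
      (\<Sum>\<^sub>\<infinity>k\<in>UNIV. ?w k * 1) - (\<Sum>\<^sub>\<infinity>k\<in>UNIV. ?w k * P k) - (\<Sum>\<^sub>\<infinity>k\<in>UNIV. ?w k * Q k)) UNIV"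
    by (intro has_sum_minus has_sum_infsum fourier_term_summable[OF m N, of _ 1]
        fourier_term_summable[OF m N P3] fourier_term_summable[OF m N Q1]) auto
  \<comment> \<open>On multiples of N this is 1 - (2 cnj e - 1) = 2 - 2 cnj e, which explains the -1
    in the second sum of the formula.\<close>
  moreover have "?w k * 1 - ?w k * P k - ?w k * Q k = ?w k *
      (if int N dvd k then 2 - 2 * cnj (?e k) else 1 - ?e k * cnj (?S k) / of_real (?W k))" for k
    by (simp add: P_def Q_def algebra_simps)
  ultimately have "(\<Sum>\<^sub>\<infinity>k\<in>UNIV. ?w k * 1) - (\<Sum>\<^sub>\<infinity>k\<in>UNIV. ?w k * P k) - (\<Sum>\<^sub>\<infinity>k\<in>UNIV. ?w k * Q k) =
      of_real (optimal_energy m N z)"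
    unfolding optimal_energy_eq_infsum[OF m N] using infsumI by fastforce
  moreover have "((-1) ^ m :: complex) * ((-1) ^ m * a - (-1) ^ m * b - (-1) ^ m * c) = a - b - c"
      for a b c
    by (simp add: right_diff_distrib)
  ultimately show ?thesis
    unfolding T1 T2 T3 dual_norm_optimal[OF m N assms(3-5)] by simp
qed

end
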